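(* Let $\mathcal{C}\subset\mathbb{R}^n$ be a degree $d$ affine rational curve with parametrization $$\varphi: t\mapsto\left(\frac{\varphi_1(t)}{\varphi_0(t)},\dots,\frac{\varphi_n(t)}{\varphi_0(t)}\right),$$ where $\varphi_0,\dots,\varphi_n\in\mathbb{R}[t]$, $\deg\varphi_i=d_i\le d$ and $D=\max\{d_1,\dots,d_n\}$. Suppose $\varphi_0$ has $p\ge 0$ distinct real zeros. Let $s\in\mathbb{N}$. Then every positive Borel measure supported on $\mathcal{C}$ with finite moments up to degree $2s-1$ admits a quadrature rule of strength $2s-1$ with at most $$N\le Ds-\left\lceil\frac{D}{2}\right\rceil+p+1$$ nodes.
   Context: A rational curve in $\mathbb{R}^n$ is a real algebraic curve of genus zero admitting a parametrization $\mathbb{R}\dashrightarrow\mathbb{R}^n$ by rational functions; it may be singular. A measure $\mu$ is supported on $\mathcal{C}$ if its support (the smallest closed set whose complement has measure zero) is contained in $\mathcal{C}$. Finite moments up to degree $k$ means that $\int x^\alpha\,d\mu$ exists and is finite for all $|\alpha|\le k$. A quadrature rule of strength $k$ for $\mu$ is a finite set of nodes $\{p_1,\dots,p_\ell\}\subset\mathbb{R}^n$ together with positive real weights $w(p_1),\dots,w(p_\ell)>0$ such that $\int p\,d\mu=\sum_{j=1}^{\ell}w(p_j)\,p(p_j)$ for all polynomials $p\in\mathbb{R}[x_1,\dots,x_n]$ of degree at most $k$; its number of nodes is $\ell$.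
   Formalization: D is taken as max{d_0,d_1,…,d_n}, including the degree of φ_0. With D = max{d_1,…,d_n} the claim fails: for the circle (1/(1+t²), t/(1+t²)) and s = 2 it would give 2 nodes of strength 3 for three non-collinear point masses. *)

theory Defs
  imports "HOL-Analysis.Analysis" "HOL-Computational_Algebra.Polynomial"
begin

definition mono_fun :: "('n::finite \<Rightarrow> nat) \<Rightarrow> 'a::field ^ 'n \<Rightarrow> 'a" where
  "mono_fun \<alpha> x = (\<Prod>i\<in>UNIV. (x $ i) ^ \<alpha> i)"

text \<open>Only used over the infinite fields of real and complex numbers, where polynomials and
  polynomial functions are the same thing. The index set of the sum is finite.\<close>

definition poly_fun_le :: "nat \<Rightarrow> ('a::field ^ 'n::finite \<Rightarrow> 'a) set" where
  "poly_fun_le k =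
     {f. \<exists>c. \<forall>x. f x = (\<Sum>\<alpha> | (\<Sum>i\<in>UNIV. \<alpha> i) \<le> k. c \<alpha> * mono_fun \<alpha> x)}"

definition poly_funs :: "('a::field ^ 'n::finite \<Rightarrow> 'a) set" where
  "poly_funs = (\<Union>k. poly_fun_le k)"

definition zariski_closure :: "('a::field ^ 'n::finite) set \<Rightarrow> ('a ^ 'n) set" where
  "zariski_closure S = {x. \<forall>f\<in>poly_funs. (\<forall>y\<in>S. f y = 0) \<longrightarrow> f x = 0}"

definition complexification :: "(real ^ 'n::finite) set \<Rightarrow> (complex ^ 'n) set" where
  "complexification C = zariski_closure ((\<lambda>x. \<chi> i. complex_of_real (x $ i)) ` C)"

text \<open>Affine hyperplanes are parametrized by their coefficient vectors; the coordinate
  \<open>None\<close> holds the constant term.\<close>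

definition hyperplane_of :: "complex ^ ('n::finite option) \<Rightarrow> (complex ^ 'n) set" where
  "hyperplane_of h = {z. h $ None + (\<Sum>i\<in>UNIV. h $ Some i * z $ i) = 0}"

text \<open>The degree of a curve is the number of points in which a generic complex hyperplane meets
  its complexification. Generic means outside the zero set of some nonzero polynomial in the
  coefficients. A generic hyperplane avoids the finitely many points at infinity, so this is also
  the degree of the projective closure.\<close>

definition curve_has_degree :: "(real ^ 'n::finite) set \<Rightarrow> nat \<Rightarrow> bool" where
  "curve_has_degree C d \<longleftrightarrow>
     (\<exists>Q\<in>poly_funs. (\<exists>h. Q h \<noteq> 0) \<and>
        (\<forall>h. Q h \<noteq> 0 \<longrightarrow>
           finite (hyperplane_of h \<inter> complexification C) \<and>
           card (hyperplane_of h \<inter> complexification C) = d))"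

definition rat_point :: "real poly \<Rightarrow> ('n::finite \<Rightarrow> real poly) \<Rightarrow> real \<Rightarrow> real ^ 'n" where
  "rat_point \<phi>0 \<phi> t = (\<chi> i. poly (\<phi> i) t / poly \<phi>0 t)"

definition rat_image :: "real poly \<Rightarrow> ('n::finite \<Rightarrow> real poly) \<Rightarrow> (real ^ 'n) set" where
  "rat_image \<phi>0 \<phi> = rat_point \<phi>0 \<phi> ` {t. poly \<phi>0 t \<noteq> 0}"

text \<open>The curve is the Zariski closure of the image. It may contain real points that are not
  attained at any real parameter: the value at infinity and isolated real singular points.
  Genus zero is automatic by Lueroth's theorem.\<close>

definition rational_curve_param ::
    "(real ^ 'n::finite) set \<Rightarrow> real poly \<Rightarrow> ('n \<Rightarrow> real poly) \<Rightarrow> bool" where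
  "rational_curve_param C \<phi>0 \<phi> \<longleftrightarrow>
     \<phi>0 \<noteq> 0 \<and> infinite (rat_image \<phi>0 \<phi>) \<and> C = zariski_closure (rat_image \<phi>0 \<phi>)"

definition measure_support :: "'a::topological_space measure \<Rightarrow> 'a set" where
  "measure_support M = \<Inter>{F. closed F \<and> emeasure M (- F) = 0}"

definition finite_moments :: "(real ^ 'n::finite) measure \<Rightarrow> nat \<Rightarrow> bool" where
  "finite_moments M k \<longleftrightarrow>
     (\<forall>\<alpha>. (\<Sum>i\<in>UNIV. \<alpha> i) \<le> k \<longrightarrow> integrable M (mono_fun \<alpha>))"

definition quadrature_rule ::
    "(real ^ 'n::finite) measure \<Rightarrow> nat \<Rightarrow> (real ^ 'n) set \<Rightarrow> (real ^ 'n \<Rightarrow> real) \<Rightarrow> bool" where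
  "quadrature_rule M k X w \<longleftrightarrow>
     finite X \<and> (\<forall>x\<in>X. w x > 0) \<and>
     (\<forall>f\<in>poly_fun_le k. integrable M f \<and> (LINT x|M. f x) = (\<Sum>x\<in>X. w x * f x))"

text \<open>The largest degree among all the polynomials of the parametrization. The denominator has to
  be included: \<open>(1 / (1 + t^2), t / (1 + t^2))\<close> parametrizes a circle with numerators
  of degree at most 1, and the bound \<open>D s - ceiling (D / 2) + p + 1\<close> with \<open>D = 1\<close>, \<open>s = 2\<close> would
  give 2 nodes of strength 3 for every measure on it. This fails for the sum of three point masses
  on the circle, as one sees by integrating the square of a linear polynomial that vanishes at
  both nodes.\<close>

definition max_degree :: "real poly \<Rightarrow> ('n::finite \<Rightarrow> real poly) \<Rightarrow> nat" where
  "max_degree \<phi>0 \<phi> = Max (insert (degree \<phi>0) (range (\<lambda>i. degree (\<phi> i))))"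

end

theory Submission
  imports Defs "HOL-Computational_Algebra.Fundamental_Theorem_Algebra"
begin

text \<open>Let \<open>k = 2 s - 1\<close>. By Tchakaloff's theorem the moments of \<open>M\<close> up to degree \<open>k\<close> are those of a
  finite measure on the curve. After division by a common factor, every point of the curve has a
  complex parameter or is the value at infinity; if the latter carries mass, a Moebius transformation
  moves it to a finite parameter. A polynomial of degree at most \<open>k\<close> pulls back to
  \<open>g / \<phi>0 ^ k\<close> with \<open>degree g \<le> D k\<close>, and if it vanishes at an isolated real point of the curve, then
  \<open>g\<close> has two conjugate nonreal roots there.

  If more than \<open>D k div 2\<close> isolated points occur, a pullback is determined by its values at them, so the
  space of pullbacks is small and Caratheodory's theorem suffices. Otherwise let \<open>z\<close> range over the poles
  and put \<open>\<rho> t = t - (\<Sum>z. 1 / (t - z))\<close>, which increases between consecutive poles, and represent the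
  moments by nodes that are isolated points or have real parameters with \<open>\<bar>\<rho>\<bar> \<le> l\<close>, for the least
  possible \<open>l\<close>. If \<open>l = 0\<close>, at most \<open>p + 1\<close> real nodes remain. If \<open>l > 0\<close>, the moments are not a conic
  combination of points with \<open>\<bar>\<rho>\<bar> < l\<close> and isolated points, so some pullback is nonnegative there and
  vanishes at all nodes. The corresponding \<open>g\<close> has double roots at the nodes with \<open>\<bar>\<rho>\<bar> < l\<close>, pairs of roots
  at the isolated ones, and simple roots at the at most \<open>2 p + 2\<close> nodes with \<open>\<bar>\<rho>\<bar> = l\<close>. Hence there are at
  most \<open>(D k + 2 p + 2) div 2\<close> nodes.\<close>

section \<open>Conic representations\<close>

text \<open>\<open>y\<close>, read on the indices in \<open>B\<close>, lies in the conic hull of the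
  vectors \<open>(b i x)\<close> with \<open>x\<close> in \<open>T\<close>. The weights are strictly
  positive, so a sum of nonnegative terms over \<open>X\<close> that is at most zero forces every
  node to be a zero.\<close>

definition conic_rep :: "('i \<Rightarrow> 'x \<Rightarrow> real) \<Rightarrow> 'i set \<Rightarrow> 'x set \<Rightarrow> ('i \<Rightarrow> real) \<Rightarrow> 'x set \<Rightarrow> ('x \<Rightarrow> real) \<Rightarrow> bool"
  where "conic_rep b B T y X w \<longleftrightarrow>
    finite X \<and> X \<subseteq> T \<and> (\<forall>x\<in>X. 0 < w x) \<and> (\<forall>i\<in>B. y i = (\<Sum>x\<in>X. w x * b i x))"

lemma conic_rep_mono: "conic_rep b B T y X w \<Longrightarrow> X \<subseteq> T' \<Longrightarrow> conic_rep b B T' y X w"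
  by (auto simp: conic_rep_def)

text \<open>Turns a weighted list with repeated points and zero weights into a proper node set:
  weights at the same point are added and zero weights are dropped.\<close>

lemma conic_rep_family:
  assumes "finite I" "\<And>j. j \<in> I \<Longrightarrow> 0 \<le> w j"
    and "\<And>j. j \<in> I \<Longrightarrow> 0 < w j \<Longrightarrow> q j \<in> T"
    and "\<And>i. i \<in> B \<Longrightarrow> y i = (\<Sum>j\<in>I. w j * b i (q j))"
  shows "\<exists>v. conic_rep b B T y (q ` {j\<in>I. 0 < w j}) v"
proof -
  let ?I = "{j\<in>I. 0 < w j}"
  define v where "v x = (\<Sum>j | j \<in> ?I \<and> q j = x. w j)" for x
  have fin: "finite ?I" using assms(1) by simp
  have pos: "0 < v x" if "x \<in> q ` ?I" for x
    unfolding v_def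
  proof (rule sum_pos)
    show "finite {j. j \<in> ?I \<and> q j = x}" using assms(1) by simp
  qed (use that in auto)
  have eq: "y i = (\<Sum>x\<in>q ` ?I. v x * b i x)" if "i \<in> B" for i
  proof -
    have "y i = (\<Sum>j\<in>?I. w j * b i (q j))"
      unfolding assms(4)[OF that]
    proof (rule sum.mono_neutral_right)
      show "\<forall>j\<in>I - ?I. w j * b i (q j) = 0"
        using assms(2) by (force simp: not_less)
    qed (use assms(1) in auto)
    also have "\<dots> = (\<Sum>x\<in>q ` ?I. \<Sum>j | j \<in> ?I \<and> q j = x. w j * b i (q j))"
      by (rule sum.image_gen[OF fin])
    also have "\<dots> = (\<Sum>x\<in>q ` ?I. v x * b i x)"
      by (intro sum.cong refl) (simp add: v_def sum_distrib_right)
    finally show ?thesis .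
  qed
  show ?thesis
    using fin pos eq assms(3) by (intro exI[of _ v]) (auto simp: conic_rep_def)
qed

text \<open>Bartl's induction: if dropping the generator \<open>z\<close> destroys the implication, a
  counterexample \<open>c0\<close> serves to project all vectors onto the hyperplane where \<open>z\<close> vanishes.\<close>

lemma farkas:
  fixes a :: "'i \<Rightarrow> 'x \<Rightarrow> real"
  assumes "finite X" "finite B"
    and "\<And>c. (\<forall>x\<in>X. 0 \<le> (\<Sum>i\<in>B. c i * a i x)) \<Longrightarrow> 0 \<le> (\<Sum>i\<in>B. c i * y i)"
  shows "\<exists>w. (\<forall>x\<in>X. 0 \<le> w x) \<and> (\<forall>i\<in>B. y i = (\<Sum>x\<in>X. w x * a i x))"
  using assms(1,3)
proof (induction X arbitrary: a y rule: finite_induct)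
  case empty
  \<comment> \<open>Without generators every functional is admissible; \<open>- y\<close> makes the
    sum of the squares nonpositive.\<close>
  have "y i = 0" if "i \<in> B" for i
  proof -
    have "0 \<le> (\<Sum>j\<in>B. (- y j) * y j)" using empty[of "\<lambda>j. - y j"] by simp
    then have "(\<Sum>j\<in>B. y j * y j) \<le> 0" by (simp add: sum_negf)
    then have "(\<Sum>j\<in>B. y j * y j) = 0" using sum_nonneg[of B "\<lambda>j. y j * y j"] by force
    then show ?thesis using that assms(2) by (simp add: sum_nonneg_eq_0_iff)
  qed
  then show ?case by simp
next
  case (insert z X)
  define ev where "ev c v = (\<Sum>i\<in>B. c i * v i)" for c v :: "'i \<Rightarrow> real"
  have ev_sub: "ev c (\<lambda>i. u i - r * v i) = ev c u - r * ev c v" for c u v r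
    by (simp add: ev_def algebra_simps sum_subtractf sum_distrib_left)
  have ev_sub': "ev (\<lambda>i. c i - r * d i) v = ev c v - r * ev d v" for c d v r
    by (simp add: ev_def algebra_simps sum_subtractf sum_distrib_left)
  have ev_scale: "ev (\<lambda>i. r * c i) v = r * ev c v" for c v r
    by (simp add: ev_def algebra_simps sum_distrib_left)
  show ?case
  proof (cases "\<forall>c. (\<forall>x\<in>X. 0 \<le> ev c (\<lambda>i. a i x)) \<longrightarrow> 0 \<le> ev c y")
    case True
    then obtain w where w: "\<forall>x\<in>X. 0 \<le> w x" "\<forall>i\<in>B. y i = (\<Sum>x\<in>X. w x * a i x)"
      using insert.IH[of a y] unfolding ev_def by blast
    let ?w = "w(z := 0)"
    have "(\<Sum>x\<in>insert z X. ?w x * a i x) = (\<Sum>x\<in>X. w x * a i x)" for i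
      using insert.hyps by (simp, intro sum.cong) auto
    then show ?thesis using w by (intro exI[of _ ?w]) auto
  next
    case False
    then obtain c1 where c1: "\<forall>x\<in>X. 0 \<le> ev c1 (\<lambda>i. a i x)" "ev c1 y < 0"
      by (auto simp: not_le)
    have neg: "ev c1 (\<lambda>i. a i z) < 0"
      using insert.prems[of c1] c1 by (force simp: ev_def)
    define c0 where "c0 = (\<lambda>i. (- 1 / ev c1 (\<lambda>i. a i z)) * c1 i)"
    have c0z: "ev c0 (\<lambda>i. a i z) = -1" using neg by (simp only: c0_def ev_scale) simp
    have c0X: "0 \<le> ev c0 (\<lambda>i. a i x)" if "x \<in> X" for x
      using neg c1(1) that unfolding c0_def ev_scale by (intro mult_nonneg_nonneg) auto
    have c0y: "ev c0 y < 0"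
      using neg c1(2) unfolding c0_def ev_scale by (intro mult_pos_neg) auto
    \<comment> \<open>Projection along the vector of \<open>z\<close> onto the kernel of
      \<open>c0\<close>: as \<open>c0\<close> is -1 at \<open>z\<close>, it vanishes on every
      \<open>a'\<close> and on \<open>y'\<close>.\<close>
    define a' where "a' i x = a i x - (- ev c0 (\<lambda>i. a i x)) * a i z" for i x
    define y' where "y' i = y i - (- ev c0 y) * a i z" for i
    have "\<exists>w. (\<forall>x\<in>X. 0 \<le> w x) \<and> (\<forall>i\<in>B. y' i = (\<Sum>x\<in>X. w x * a' i x))"
    proof (rule insert.IH)
      fix c assume c: "\<forall>x\<in>X. 0 \<le> (\<Sum>i\<in>B. c i * a' i x)"
      \<comment> \<open>On the original vectors \<open>d\<close> takes the values that
        \<open>c\<close> takes on the projected ones, and it is zero at \<open>z\<close>; hence the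
        hypothesis for \<open>insert z X\<close> applies to \<open>d\<close>.\<close>
      define d where "d = (\<lambda>i. c i - (- ev c (\<lambda>i. a i z)) * c0 i)"
      have dX: "ev d (\<lambda>i. a i x) = ev c (\<lambda>i. a' i x)" for x
        unfolding d_def a'_def ev_sub ev_sub' by simp
      have dz: "ev d (\<lambda>i. a i z) = 0" unfolding d_def ev_sub' c0z by simp
      have dy: "ev d y = ev c y'" unfolding d_def y'_def ev_sub ev_sub' by simp
      have "0 \<le> ev d y"
        using insert.prems[of d] dX dz c by (simp add: ev_def)
      then show "0 \<le> (\<Sum>i\<in>B. c i * y' i)" using dy by (simp add: ev_def)
    qed
    then obtain w where w: "\<forall>x\<in>X. 0 \<le> w x" "\<forall>i\<in>B. y' i = (\<Sum>x\<in>X. w x * a' i x)"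
      by blast
    \<comment> \<open>The coefficient of \<open>z\<close> that remains when the projections are
      undone. The signs of \<open>c0\<close> on \<open>X\<close> and at \<open>y\<close> make it
      nonnegative.\<close>
    define wz where "wz = (\<Sum>x\<in>X. w x * ev c0 (\<lambda>i. a i x)) - ev c0 y"
    have wz: "0 \<le> wz" unfolding wz_def using w(1) c0X c0y
      by (smt (verit) mult_nonneg_nonneg sum_nonneg)
    let ?w = "w(z := wz)"
    have "y i = (\<Sum>x\<in>insert z X. ?w x * a i x)" if "i \<in> B" for i
    proof -
      have "y i = (\<Sum>x\<in>X. w x * a' i x) - ev c0 y * a i z"
        using w(2) that by (auto simp: y'_def)
      also have "\<dots> = (\<Sum>x\<in>X. w x * a i x) + wz * a i z"
        by (simp add: a'_def wz_def algebra_simps sum.distrib sum_distrib_left)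
      also have "(\<Sum>x\<in>X. w x * a i x) = (\<Sum>x\<in>X. ?w x * a i x)"
        using insert.hyps by (intro sum.cong) auto
      finally show ?thesis using insert.hyps by simp
    qed
    then show ?thesis using w(1) wz by (intro exI[of _ ?w]) auto
  qed
qed

text \<open>Gaussian elimination: an equation \<open>k\<close> with a nonzero coefficient at
  \<open>z\<close> serves to remove the unknown \<open>z\<close> from the other equations, which
  lowers both counts by one.\<close>

lemma homogeneous_system:
  fixes a :: "'i \<Rightarrow> 'x \<Rightarrow> real"
  assumes "finite B" "finite X" "card B < card X"
  shows "\<exists>u. (\<exists>x\<in>X. u x \<noteq> 0) \<and> (\<forall>i\<in>B. (\<Sum>x\<in>X. u x * a i x) = 0)"
  using assms
proof (induction B arbitrary: a X rule: finite_induct)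
  case empty
  then have "X \<noteq> {}" by auto
  then show ?case by (intro exI[of _ "\<lambda>_. 1"]) auto
next
  case (insert k B)
  show ?case
  proof (cases "\<forall>x\<in>X. a k x = 0")
    case True
    then show ?thesis using insert.IH[of X a] insert.prems insert.hyps by force
  next
    case False
    then obtain z where z: "z \<in> X" "a k z \<noteq> 0" by blast
    define a' where "a' i x = a i x - a k x / a k z * a i z" for i x
    have "\<exists>u. (\<exists>x\<in>X-{z}. u x \<noteq> 0) \<and> (\<forall>i\<in>B. (\<Sum>x\<in>X-{z}. u x * a' i x) = 0)"
      using insert.prems insert.hyps z by (intro insert.IH) auto
    then obtain u where u: "\<exists>x\<in>X-{z}. u x \<noteq> 0" "\<forall>i\<in>B. (\<Sum>x\<in>X-{z}. u x * a' i x) = 0"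
      by blast
    define uz where "uz = - (\<Sum>x\<in>X-{z}. u x * a k x) / a k z"
    let ?u = "u(z := uz)"
    have split: "(\<Sum>x\<in>X. ?u x * a i x) = uz * a i z + (\<Sum>x\<in>X-{z}. u x * a i x)" for i
    proof -
      have "(\<Sum>x\<in>X. ?u x * a i x) = uz * a i z + (\<Sum>x\<in>X-{z}. ?u x * a i x)"
        using insert.prems z(1) by (subst sum.remove[of X z]) auto
      also have "(\<Sum>x\<in>X-{z}. ?u x * a i x) = (\<Sum>x\<in>X-{z}. u x * a i x)"
        by (intro sum.cong) auto
      finally show ?thesis .
    qed
    have "(\<Sum>x\<in>X. ?u x * a i x) = (\<Sum>x\<in>X-{z}. u x * a' i x)" for i
    proof -
      have "(\<Sum>x\<in>X-{z}. u x * a' i x)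
        = (\<Sum>x\<in>X-{z}. u x * a i x - u x * a k x * (a i z / a k z))"
        by (intro sum.cong refl) (simp add: a'_def algebra_simps)
      also have "\<dots> = (\<Sum>x\<in>X-{z}. u x * a i x) + uz * a i z"
        unfolding sum_subtractf sum_distrib_right[symmetric] by (simp add: uz_def)
      finally show ?thesis using split[of i] by simp
    qed
    moreover have "(\<Sum>x\<in>X-{z}. u x * a' k x) = 0"
      using z by (simp add: a'_def)
    ultimately show ?thesis using u by (intro exI[of _ ?u]) auto
  qed
qed

text \<open>With more nodes than functions there is a linear relation between the nodes. Shifting
  the weights along it until the first one reaches zero removes a node and keeps all sums.\<close>

lemma caratheodory_conic:
  assumes "finite B" "conic_rep b B T y X w"
  shows "\<exists>X' w'. X' \<subseteq> X \<and> card X' \<le> card B \<and> conic_rep b B T y X' w'"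
  using assms(2)
proof (induction "card X" arbitrary: X w rule: less_induct)
  case less
  then have X: "finite X" "X \<subseteq> T" "\<And>x. x \<in> X \<Longrightarrow> 0 < w x"
    and y: "\<And>i. i \<in> B \<Longrightarrow> y i = (\<Sum>x\<in>X. w x * b i x)"
    by (auto simp: conic_rep_def)
  show ?case
  proof (cases "card X \<le> card B")
    case True
    then show ?thesis using less.prems by blast
  next
    case False
    then obtain u where u: "\<exists>x\<in>X. u x \<noteq> 0" "\<forall>i\<in>B. (\<Sum>x\<in>X. u x * b i x) = 0"
      using homogeneous_system[OF assms(1) X(1), of b] by auto
    obtain v where v: "\<exists>x\<in>X. 0 < v x" "\<forall>i\<in>B. (\<Sum>x\<in>X. v x * b i x) = 0"
    proof (cases "\<exists>x\<in>X. 0 < u x")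
      case True
      then show ?thesis using that u by blast
    next
      case False
      then have "\<exists>x\<in>X. 0 < - u x" using u(1) by (force simp: not_less)
      then show ?thesis using that[of "\<lambda>x. - u x"] u(2) by (simp add: sum_negf)
    qed
    define P where "P = {x\<in>X. 0 < v x}"
    have P: "finite P" "P \<noteq> {}" using X(1) v(1) by (auto simp: P_def)
    \<comment> \<open>The longest shift that keeps all weights nonnegative; the minimiser
      \<open>z\<close> loses its weight.\<close>
    define r where "r = Min ((\<lambda>x. w x / v x) ` P)"
    have "r \<in> (\<lambda>x. w x / v x) ` P" unfolding r_def using P by (intro Min_in) auto
    then obtain z where z: "z \<in> P" "r = w z / v z" by blast
    have rle: "r \<le> w x / v x" if "x \<in> P" for x
      unfolding r_def using P that by auto
    have r0: "0 < r" using z X(3) by (auto simp: P_def)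
    have nonneg: "0 \<le> w x - r * v x" if "x \<in> X" for x
    proof (cases "0 < v x")
      case True
      then show ?thesis using rle[of x] that by (simp add: P_def field_simps)
    next
      case False
      then have "r * v x \<le> 0" using r0 by (simp add: mult_nonneg_nonpos)
      then show ?thesis using X(3)[OF that] by linarith
    qed
    have eq: "y i = (\<Sum>x\<in>X. (w x - r * v x) * b i x)" if "i \<in> B" for i
    proof -
      have "(\<Sum>x\<in>X. (w x - r * v x) * b i x) = (\<Sum>x\<in>X. w x * b i x) - r * (\<Sum>x\<in>X. v x * b i x)"
        by (simp add: algebra_simps sum_subtractf sum_distrib_left)
      then show ?thesis using y v(2) that by simp
    qed
    have "\<exists>w'. conic_rep b B T y ((\<lambda>x. x) ` {x\<in>X. 0 < w x - r * v x}) w'"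
      using X nonneg eq by (intro conic_rep_family) auto
    then obtain w' where w': "conic_rep b B T y {x\<in>X. 0 < w x - r * v x} w'" by auto
    have "{x\<in>X. 0 < w x - r * v x} \<subset> X"
    proof -
      have "z \<in> X" "\<not> 0 < w z - r * v z" using z by (auto simp: P_def)
      then show ?thesis by blast
    qed
    then have "card {x\<in>X. 0 < w x - r * v x} < card X" using X(1) by (rule psubset_card_mono[rotated])
    from less.hyps[OF this w'] show ?thesis by blast
  qed
qed

text \<open>Farkas' lemma separates \<open>y\<close> from each finite part of \<open>T\<close>.
  Normalised to maximum norm 1, the separating coefficients lie in a compact set, so the finite
  intersection property yields coefficients that serve all of \<open>T\<close>. The strict
  inequality at \<open>y\<close> becomes weak, but the coefficients stay nonzero.\<close>

lemma conic_separation: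
  fixes b :: "'i \<Rightarrow> 'x \<Rightarrow> real"
  assumes "finite B" "\<nexists>X w. conic_rep b B T y X w"
  shows "\<exists>c. (\<exists>i\<in>B. c i \<noteq> 0) \<and> (\<forall>x\<in>T. 0 \<le> (\<Sum>i\<in>B. c i * b i x)) \<and> (\<Sum>i\<in>B. c i * y i) \<le> 0"
proof -
  \<comment> \<open>Coordinates outside \<open>B\<close> are bounded too, so that \<open>K\<close>
    is compact in the full product space.\<close>
  define K where "K = (UNIV \<rightarrow> {-1..1::real}) \<inter> {c. \<exists>i\<in>B. \<bar>c i\<bar> = 1}"
  have clI: "closed {c::'i \<Rightarrow> real. \<bar>c i\<bar> = 1}" for i
    by (intro closed_Collect_eq continuous_intros continuous_on_product_coordinates)
  have eqU: "{c::'i \<Rightarrow> real. \<exists>i\<in>B. \<bar>c i\<bar> = 1} = (\<Union>i\<in>B. {c. \<bar>c i\<bar> = 1})" by auto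
  have "compactin (product_topology (\<lambda>i::'i. euclidean) UNIV) (PiE UNIV (\<lambda>_. {-1..1::real}))"
    by (subst compactin_PiE) auto
  then have "compact (UNIV \<rightarrow> {-1..1::real} :: ('i \<Rightarrow> real) set)"
    by (simp add: euclidean_product_topology PiE_def)
  then have cK: "compact K" unfolding K_def eqU
    using assms(1) clI by (intro compact_Int_closed closed_UN) auto
  have cont: "continuous_on UNIV (\<lambda>c::'i \<Rightarrow> real. \<Sum>i\<in>B. c i * v i)" for v :: "'i \<Rightarrow> real"
    by (intro continuous_intros continuous_on_product_coordinates)
  define G where "G x = {c. 0 \<le> (\<Sum>i\<in>B. c i * b i x)}" for x
  define G0 where "G0 = {c::'i\<Rightarrow>real. (\<Sum>i\<in>B. c i * y i) \<le> 0}"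
  have fip: "K \<inter> \<Inter>(insert G0 (G ` X)) \<noteq> {}" if X: "finite X" "X \<subseteq> T" for X
  proof -
    have "\<not> (\<exists>w. (\<forall>x\<in>X. 0 \<le> w x) \<and> (\<forall>i\<in>B. y i = (\<Sum>x\<in>X. w x * b i x)))"
    proof
      assume "\<exists>w. (\<forall>x\<in>X. 0 \<le> w x) \<and> (\<forall>i\<in>B. y i = (\<Sum>x\<in>X. w x * b i x))"
      then obtain w where w: "\<forall>x\<in>X. 0 \<le> w x" "\<forall>i\<in>B. y i = (\<Sum>x\<in>X. w x * b i x)"
        by (elim exE conjE)
      have "\<exists>v. conic_rep b B T y ((\<lambda>x. x) ` {x\<in>X. 0 < w x}) v"
        by (rule conic_rep_family[OF X(1)]) (use w X(2) in auto)
      then show False using assms(2) by (elim exE notE) (intro exI)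
    qed
    then have "\<not> (\<forall>c. (\<forall>x\<in>X. 0 \<le> (\<Sum>i\<in>B. c i * b i x)) \<longrightarrow> 0 \<le> (\<Sum>i\<in>B. c i * y i))"
      using farkas[OF X(1) assms(1), where a = b and y = y] by (auto simp only:)
    then obtain c where c: "\<forall>x\<in>X. 0 \<le> (\<Sum>i\<in>B. c i * b i x)" "(\<Sum>i\<in>B. c i * y i) < 0"
      unfolding not_all not_imp not_le by (elim exE conjE)
    define m where "m = Max ((\<lambda>i. \<bar>c i\<bar>) ` B)"
    have B: "B \<noteq> {}" using c(2) by auto
    have "m \<in> (\<lambda>i. \<bar>c i\<bar>) ` B" unfolding m_def using B assms(1) by (intro Max_in) auto
    then obtain k where k: "k \<in> B" "m = \<bar>c k\<bar>" by blast
    have mge: "\<bar>c i\<bar> \<le> m" if "i \<in> B" for i unfolding m_def using assms(1) that by auto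
    have m0: "0 < m"
    proof (rule ccontr)
      assume "\<not> 0 < m"
      then have "c i = 0" if "i \<in> B" for i using mge[OF that] by auto
      then show False using c(2) by simp
    qed
    define c' where "c' i = (if i \<in> B then c i / m else 0)" for i
    have s: "(\<Sum>i\<in>B. c' i * v i) = (\<Sum>i\<in>B. c i * v i) / m" for v
      unfolding sum_divide_distrib by (intro sum.cong) (auto simp: c'_def)
    have "c' i \<in> {-1..1}" for i
      using mge[of i] m0 by (auto simp: c'_def field_simps abs_le_iff)
    moreover have "\<bar>c' k\<bar> = 1" using k m0 by (auto simp: c'_def)
    ultimately have "c' \<in> K" using k(1) by (auto simp: K_def)
    moreover have "c' \<in> \<Inter>(insert G0 (G ` X))"
      using c m0 by (auto simp: G_def G0_def s divide_nonpos_pos)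
    ultimately show ?thesis by blast
  qed
  have clG: "closed (G x)" "closed G0" for x
    unfolding G_def G0_def
    by (intro closed_Collect_le continuous_on_const cont)+
  have "K \<inter> \<Inter>(insert G0 (G ` T)) \<noteq> {}"
  proof (rule compact_imp_fip[OF cK])
    fix F assume F: "finite F" "F \<subseteq> insert G0 (G ` T)"
    then have "finite (F - {G0})" "F - {G0} \<subseteq> G ` T" by auto
    from finite_subset_image[OF this] obtain X where X: "X \<subseteq> T" "finite X" "F - {G0} = G ` X"
      by (elim exE conjE)
    have "F \<subseteq> insert G0 (F - {G0})" by auto
    then have "\<Inter>(insert G0 (G ` X)) \<subseteq> \<Inter>F" unfolding X(3) by (rule Inter_anti_mono)
    then have "K \<inter> \<Inter>(insert G0 (G ` X)) \<subseteq> K \<inter> \<Inter>F" by (rule Int_mono[OF order_refl])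
    then show "K \<inter> \<Inter>F \<noteq> {}" using fip[OF X(2,1)] by (metis subset_empty)
  qed (use clG in auto)
  then obtain c where "c \<in> K" "c \<in> G0" "\<And>x. x \<in> T \<Longrightarrow> c \<in> G x" by blast
  then show ?thesis by (intro exI[of _ c]) (force simp: K_def G_def G0_def)
qed

section \<open>Spanning subfamilies and Tchakaloff's theorem\<close>

definition spanning :: "('i \<Rightarrow> 'x \<Rightarrow> real) \<Rightarrow> 'i set \<Rightarrow> 'x set \<Rightarrow> 'i set \<Rightarrow> bool" where
  "spanning b A T B \<longleftrightarrow> B \<subseteq> A \<and> (\<forall>i\<in>A. \<exists>d. \<forall>x\<in>T. b i x = (\<Sum>j\<in>B. d j * b j x))"

lemma spanning_refl:
  assumes "finite A" shows "spanning b A T A"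
  unfolding spanning_def
proof (intro conjI ballI)
  fix i assume "i \<in> A"
  then have "b i x = (\<Sum>j\<in>A. (if j = i then 1 else 0) * b j x)" for x
    using assms by (simp add: if_distrib if_distribR cong: if_cong)
  then show "\<exists>d. \<forall>x\<in>T. b i x = (\<Sum>j\<in>A. d j * b j x)"
    by (intro exI[of _ "\<lambda>j. if j = i then 1 else 0"]) simp
qed simp

text \<open>The relation \<open>c\<close> expresses \<open>b k\<close> through the other functions,
  but only on \<open>T'\<close>. This set may be smaller than \<open>T\<close>, as when it is the
  zero set of a nonnegative function.\<close>

lemma spanning_remove:
  assumes "finite B" "spanning b A T B" "k \<in> B" "c k \<noteq> 0" "T' \<subseteq> T"
    and c: "\<And>x. x \<in> T' \<Longrightarrow> (\<Sum>j\<in>B. c j * b j x) = 0"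
  shows "spanning b A T' (B - {k})"
  unfolding spanning_def
proof (intro conjI ballI)
  fix i assume "i \<in> A"
  then obtain d where d: "\<And>x. x \<in> T \<Longrightarrow> b i x = (\<Sum>j\<in>B. d j * b j x)"
    using assms(2) unfolding spanning_def by metis
  have "b i x = (\<Sum>j\<in>B-{k}. (d j - d k * c j / c k) * b j x)" if x: "x \<in> T'" for x
  proof -
    have "b i x = (\<Sum>j\<in>B. d j * b j x) - d k / c k * (\<Sum>j\<in>B. c j * b j x)"
      using c[OF x] d x assms(5) by auto
    also have "\<dots> = (\<Sum>j\<in>B. (d j - d k * c j / c k) * b j x)"
      by (simp add: algebra_simps sum_subtractf sum_distrib_left)
    also have "\<dots> = (\<Sum>j\<in>B-{k}. (d j - d k * c j / c k) * b j x)"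
      using assms(1,3,4) by (subst sum.remove[of _ k]) auto
    finally show ?thesis .
  qed
  then show "\<exists>d. \<forall>x\<in>T'. b i x = (\<Sum>j\<in>B-{k}. d j * b j x)"
    by (intro exI[of _ "\<lambda>j. d j - d k * c j / c k"]) blast
qed (use assms(2) in \<open>auto simp: spanning_def\<close>)

text \<open>A spanning subfamily of least size is linearly independent on \<open>T\<close>, since a
  relation would permit the removal of a member.\<close>

lemma basis_exists:
  assumes "finite A"
  shows "\<exists>B. spanning b A T B \<and>
    (\<forall>c. (\<forall>x\<in>T. (\<Sum>j\<in>B. c j * b j x) = 0) \<longrightarrow> (\<forall>j\<in>B. c j = 0))"
proof -
  obtain B where B: "spanning b A T B" and min: "\<And>B'. spanning b A T B' \<Longrightarrow> card B \<le> card B'"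
    using exists_least_iff[of "\<lambda>n. \<exists>B. spanning b A T B \<and> card B = n"] spanning_refl[OF assms, of b T]
    by (metis (no_types, lifting) not_less)
  have fin: "finite B" using B assms by (auto simp: spanning_def intro: finite_subset)
  have "c k = 0" if "\<forall>x\<in>T. (\<Sum>j\<in>B. c j * b j x) = 0" "k \<in> B" for c k
  proof (rule ccontr)
    assume "c k \<noteq> 0"
    then have "spanning b A T (B - {k})"
      using that by (intro spanning_remove[OF fin B]) auto
    from min[OF this] show False using that fin card_Diff1_less[of B k] by simp
  qed
  then show ?thesis using B by blast
qed

text \<open>The representation by \<open>X0\<close> shows that \<open>y\<close> obeys all linear
  relations that the functions satisfy on \<open>T\<close>, so its values on \<open>B\<close>
  determine those on \<open>A\<close>.\<close>

lemma conic_rep_spanning: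
  assumes "spanning b A T B" "conic_rep b A T y X0 w0" "conic_rep b B T y X w"
  shows "conic_rep b A T y X w"
proof -
  have X0: "finite X0" "X0 \<subseteq> T" "\<And>i. i \<in> A \<Longrightarrow> y i = (\<Sum>x\<in>X0. w0 x * b i x)"
    and X: "finite X" "X \<subseteq> T" "\<And>i. i \<in> B \<Longrightarrow> y i = (\<Sum>x\<in>X. w x * b i x)"
    using assms(2,3) by (auto simp: conic_rep_def)
  have "y i = (\<Sum>x\<in>X. w x * b i x)" if i: "i \<in> A" for i
  proof -
    obtain d where d: "\<And>x. x \<in> T \<Longrightarrow> b i x = (\<Sum>j\<in>B. d j * b j x)"
      using assms(1) i unfolding spanning_def by metis
    have *: "(\<Sum>x\<in>Y. v x * b i x) = (\<Sum>j\<in>B. d j * (\<Sum>x\<in>Y. v x * b j x))" if "Y \<subseteq> T" for Y v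
    proof -
      have "(\<Sum>x\<in>Y. v x * b i x) = (\<Sum>x\<in>Y. \<Sum>j\<in>B. d j * (v x * b j x))"
        using that d by (intro sum.cong) (auto simp: sum_distrib_left algebra_simps)
      also have "\<dots> = (\<Sum>j\<in>B. d j * (\<Sum>x\<in>Y. v x * b j x))"
        by (subst sum.swap) (simp add: sum_distrib_left)
      finally show ?thesis .
    qed
    have "B \<subseteq> A" using assms(1) by (auto simp: spanning_def)
    then have "(\<Sum>x\<in>X0. w0 x * b j x) = (\<Sum>x\<in>X. w x * b j x)" if "j \<in> B" for j
      using X(3)[OF that] X0(3)[of j] that by auto
    then have "(\<Sum>x\<in>X0. w0 x * b i x) = (\<Sum>x\<in>X. w x * b i x)"
      unfolding *[OF X0(2)] *[OF X(2)] by (intro sum.cong refl) simp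
    then show ?thesis using X0(3)[OF i] by simp
  qed
  then show ?thesis using assms(3) by (auto simp: conic_rep_def)
qed

text \<open>Tchakaloff's theorem in the form of Bayer and Teichmann: if the conic hull over the carrier
  misses the moments, a separating function has integral zero, so it vanishes almost everywhere and
  the measure lives on a carrier on which the functions span a smaller space.\<close>

lemma tchakaloff:
  fixes b :: "'i \<Rightarrow> 'x \<Rightarrow> real"
  assumes A: "finite A" and int: "\<And>i. i \<in> A \<Longrightarrow> integrable M (b i)" and T: "AE x in M. x \<in> T"
  shows "\<exists>X w. conic_rep b A T (\<lambda>i. LINT x|M. b i x) X w"
proof -
  define y where "y i = (LINT x|M. b i x)" for i
  \<comment> \<open>Carrier and spanning subfamily are minimised together, so no subset of
    \<open>T\<close> of full measure admits a smaller spanning subfamily.\<close>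
  define Q where "Q n \<longleftrightarrow> (\<exists>S B. S \<subseteq> T \<and> (AE x in M. x \<in> S) \<and> spanning b A S B \<and> card B = n)" for n
  have "Q (card A)" unfolding Q_def using spanning_refl[OF A] T by blast
  then obtain n where "Q n" "\<And>m. m < n \<Longrightarrow> \<not> Q m" using exists_least_iff[of Q] by blast
  then obtain S B where S: "S \<subseteq> T" "AE x in M. x \<in> S" and B: "spanning b A S B"
    and min: "\<And>S' B'. S' \<subseteq> T \<Longrightarrow> AE x in M. x \<in> S' \<Longrightarrow> spanning b A S' B' \<Longrightarrow> card B \<le> card B'"
    unfolding Q_def by (metis not_less)
  have BA: "B \<subseteq> A" and fin: "finite B"
    using B A by (auto simp: spanning_def intro: finite_subset)
  have "\<exists>X w. conic_rep b B S y X w"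
  proof (rule ccontr)
    assume "\<nexists>X w. conic_rep b B S y X w"
    from conic_separation[OF fin this] obtain c k where c: "k \<in> B" "c k \<noteq> 0"
      "\<And>x. x \<in> S \<Longrightarrow> 0 \<le> (\<Sum>i\<in>B. c i * b i x)" "(\<Sum>i\<in>B. c i * y i) \<le> 0" by blast
    let ?f = "\<lambda>x. \<Sum>i\<in>B. c i * b i x"
    have if': "integrable M ?f" using int BA by (intro Bochner_Integration.integrable_sum) auto
    have nn: "AE x in M. 0 \<le> ?f x" using S(2) by eventually_elim (rule c(3))
    have "(LINT x|M. ?f x) = (\<Sum>i\<in>B. LINT x|M. c i * b i x)"
      using int BA by (intro Bochner_Integration.integral_sum) auto
    also have "\<dots> = (\<Sum>i\<in>B. c i * y i)" by (simp add: y_def)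
    finally have "(LINT x|M. ?f x) = 0"
      using c(4) integral_nonneg_AE[OF nn] by linarith
    then have "AE x in M. ?f x = 0" using integral_nonneg_eq_0_iff_AE[OF if' nn] by simp
    with S(2) have "AE x in M. x \<in> {x\<in>S. ?f x = 0}" by eventually_elim auto
    moreover have "spanning b A {x\<in>S. ?f x = 0} (B - {k})"
      using c by (intro spanning_remove[OF fin B]) auto
    ultimately have "card B \<le> card (B - {k})" using S(1) by (intro min) auto
    then show False using c(1) fin card_Diff1_less[of B k] by simp
  qed
  then obtain X w where Xw: "conic_rep b B S y X w" by blast
  then have X: "finite X" "X \<subseteq> S" "\<And>i. i \<in> B \<Longrightarrow> y i = (\<Sum>x\<in>X. w x * b i x)"
    by (auto simp: conic_rep_def)
  have "y i = (\<Sum>x\<in>X. w x * b i x)" if i: "i \<in> A" for i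
  proof -
    obtain d where d: "\<And>x. x \<in> S \<Longrightarrow> b i x = (\<Sum>j\<in>B. d j * b j x)"
      using B i unfolding spanning_def by metis
    have "y i = (LINT x|M. (\<Sum>j\<in>B. d j * b j x))" unfolding y_def
    proof (rule integral_cong_AE)
      show "AE x in M. b i x = (\<Sum>j\<in>B. d j * b j x)" using S(2) by eventually_elim (rule d)
      show "b i \<in> borel_measurable M" using int[OF i] by simp
      show "(\<lambda>x. \<Sum>j\<in>B. d j * b j x) \<in> borel_measurable M"
        using int BA by (intro borel_measurable_sum borel_measurable_times) auto
    qed
    also have "\<dots> = (\<Sum>j\<in>B. LINT x|M. d j * b j x)"
      using int BA by (intro Bochner_Integration.integral_sum) auto
    also have "\<dots> = (\<Sum>j\<in>B. d j * y j)" by (simp add: y_def)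
    also have "\<dots> = (\<Sum>j\<in>B. \<Sum>x\<in>X. w x * (d j * b j x))"
      using X(3) by (intro sum.cong) (auto simp: sum_distrib_left algebra_simps)
    also have "\<dots> = (\<Sum>x\<in>X. \<Sum>j\<in>B. w x * (d j * b j x))" by (rule sum.swap)
    also have "\<dots> = (\<Sum>x\<in>X. w x * b i x)"
      using X(2) d by (intro sum.cong) (auto simp: sum_distrib_left)
    finally show ?thesis .
  qed
  then have "conic_rep b A T y X w" using Xw S(1) by (auto simp: conic_rep_def)
  then show ?thesis unfolding y_def by blast
qed

section \<open>Roots of real polynomials\<close>

abbreviation cpoly :: "real poly \<Rightarrow> complex poly" where
  "cpoly \<equiv> map_poly complex_of_real"

lemma cpoly_add: "cpoly (p + q) = cpoly p + cpoly q"
  by (rule poly_eqI) (simp add: coeff_map_poly)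

lemma cpoly_mult: "cpoly (p * q) = cpoly p * cpoly q"
  by (rule poly_eqI) (simp add: coeff_map_poly coeff_mult)

lemma cpoly_smult: "cpoly (smult c p) = smult (complex_of_real c) (cpoly p)"
  by (rule poly_eqI) (simp add: coeff_map_poly)

lemma cpoly_sum: "cpoly (\<Sum>i\<in>I. f i) = (\<Sum>i\<in>I. cpoly (f i))"
  by (induction I rule: infinite_finite_induct) (auto simp: cpoly_add)

lemma cpoly_prod: "cpoly (\<Prod>i\<in>I. f i) = (\<Prod>i\<in>I. cpoly (f i))"
  by (induction I rule: infinite_finite_induct) (auto simp: cpoly_mult)

lemma cpoly_power: "cpoly (p ^ n) = cpoly p ^ n"
  by (induction n) (auto simp: cpoly_mult)

lemma poly_cpoly_of_real [simp]: "poly (cpoly p) (of_real x) = of_real (poly p x)"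
  by (induction p) (auto simp: map_poly_pCons)

lemma poly_cpoly_cnj: "poly (cpoly p) (cnj x) = cnj (poly (cpoly p) x)"
  by (induction p) (auto simp: map_poly_pCons)

lemma cpoly_eq_0_iff [simp]: "cpoly p = 0 \<longleftrightarrow> p = 0"
  by (auto simp: map_poly_eq_0_iff)

lemma degree_cpoly [simp]: "degree (cpoly p) = degree p"
  by (rule degree_map_poly) simp

lemma sum_order_le_degree:
  fixes p :: "complex poly"
  assumes "p \<noteq> 0" "finite Y"
  shows "(\<Sum>x\<in>Y. order x p) \<le> degree p"
proof -
  have "(\<Sum>x\<in>Y. order x p) = (\<Sum>x\<in>Y. count (proots p) x)"
    using assms(1) by simp
  also have "\<dots> \<le> (\<Sum>x\<in>Y \<union> set_mset (proots p). count (proots p) x)"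
    using assms(2) by (intro sum_mono2) auto
  also have "\<dots> = (\<Sum>x\<in>set_mset (proots p). count (proots p) x)"
    using assms(2) by (intro sum.mono_neutral_right) (auto simp: not_in_iff[symmetric])
  also have "\<dots> \<le> degree p"
    using size_proots_le[of p] by (simp add: size_multiset_overloaded_eq)
  finally show ?thesis .
qed

text \<open>A point of \<open>J\<close> brings its conjugate as a second root, a point of
  \<open>R\<close> counts twice and a point of \<open>E\<close> once; all these roots are
  different.\<close>

lemma root_count:
  fixes g :: "real poly"
  assumes g: "g \<noteq> 0" and fin: "finite J" "finite R" "finite E" and RE: "R \<inter> E = {}"
    and J: "\<And>z. z \<in> J \<Longrightarrow> 0 < Im z \<and> poly (cpoly g) z = 0"
    and R: "\<And>x. x \<in> R \<Longrightarrow> [:-x, 1:]^2 dvd g" and E: "\<And>x. x \<in> E \<Longrightarrow> poly g x = 0"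
  shows "2 * card J + 2 * card R + card E \<le> degree g"
proof -
  let ?o = "\<lambda>x. order x (cpoly g)"
  have g': "cpoly g \<noteq> 0" using g by simp
  have o1: "1 \<le> ?o x" if "poly (cpoly g) x = 0" for x
    using order_gt_0_iff[OF g', of x] that by simp
  have o2: "2 \<le> ?o (of_real x)" if x: "x \<in> R" for x
  proof -
    obtain h where "g = [:-x, 1:]^2 * h" using R[OF x] by (elim dvdE)
    then have "cpoly g = [:- complex_of_real x, 1:]^2 * cpoly h"
      by (simp add: cpoly_mult cpoly_power map_poly_pCons)
    then have "[:- complex_of_real x, 1:]^2 dvd cpoly g" by simp
    then show ?thesis using g' by (simp only: order_divides) simp
  qed
  have inj: "inj_on cnj J" "inj_on complex_of_real Y" for Y by (auto simp: inj_on_def)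
  have "(\<Sum>z\<in>J. ?o z) + (\<Sum>z\<in>cnj ` J. ?o z) + (\<Sum>z\<in>complex_of_real ` R. ?o z)
      + (\<Sum>z\<in>complex_of_real ` E. ?o z)
    = (\<Sum>z\<in>((J \<union> cnj ` J) \<union> complex_of_real ` R) \<union> complex_of_real ` E. ?o z)"
  proof -
    have ne: "cnj w \<notin> J" "complex_of_real x \<notin> J" "complex_of_real x \<noteq> cnj w" if "w \<in> J" for w x
      using J[OF that] J[of "cnj w"] J[of "of_real x"] by (auto simp: complex_eq_iff)
    have ne': "complex_of_real x \<notin> J" for x
      using J[of "of_real x"] by auto
    have "J \<inter> cnj ` J = {}" "(J \<union> cnj ` J) \<inter> complex_of_real ` R = {}"
      "((J \<union> cnj ` J) \<union> complex_of_real ` R) \<inter> complex_of_real ` E = {}"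
      using ne ne' RE by auto
    then show ?thesis using fin by (simp add: sum.union_disjoint)
  qed
  also have "\<dots> \<le> degree g"
    using sum_order_le_degree[OF g'] fin by simp
  finally have *: "(\<Sum>z\<in>J. ?o z) + (\<Sum>z\<in>cnj ` J. ?o z) + (\<Sum>z\<in>complex_of_real ` R. ?o z)
      + (\<Sum>z\<in>complex_of_real ` E. ?o z) \<le> degree g" .
  have "card J \<le> (\<Sum>z\<in>J. ?o z)"
    using sum_mono[of J "\<lambda>_. 1" ?o] o1 J by auto
  moreover have "card J \<le> (\<Sum>z\<in>cnj ` J. ?o z)"
    unfolding sum.reindex[OF inj(1)]
    using sum_mono[of J "\<lambda>_. 1" "?o \<circ> cnj"] o1 J by (auto simp: poly_cpoly_cnj)
  moreover have "2 * card R \<le> (\<Sum>z\<in>complex_of_real ` R. ?o z)"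
    unfolding sum.reindex[OF inj(2)]
    using sum_mono[of R "\<lambda>_. 2" "?o \<circ> complex_of_real"] o2 by (auto simp: mult.commute)
  moreover have "card E \<le> (\<Sum>z\<in>complex_of_real ` E. ?o z)"
    unfolding sum.reindex[OF inj(2)]
    using sum_mono[of E "\<lambda>_. 1" "?o \<circ> complex_of_real"] o1 E by auto
  ultimately show ?thesis using * by linarith
qed

text \<open>At a simple root of \<open>g\<close> the quotient would change sign, because
  \<open>q\<close> does not vanish there.\<close>

lemma double_root:
  fixes g q :: "real poly"
  assumes gx: "poly g x = 0" and qx: "poly q x \<noteq> 0" and e: "0 < e"
    and nn: "\<And>t. \<bar>t - x\<bar> < e \<Longrightarrow> 0 \<le> poly g t / poly q t"
  shows "[:-x, 1:]^2 dvd g"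
proof -
  obtain h where h: "g = [:-x, 1:] * h" using gx by (auto simp: poly_eq_0_iff_dvd elim: dvdE)
  have "poly h x = 0"
  proof (rule ccontr)
    assume hx: "poly h x \<noteq> 0"
    define r where "r t = poly h t / poly q t" for t
    have "r x \<noteq> 0" using hx qx by (simp add: r_def)
    then have rx: "0 < r x * r x" by (auto simp: zero_less_mult_iff neq_iff)
    have "isCont (\<lambda>t. r t * r x) x" unfolding r_def using qx by (intro continuous_intros) auto
    then have "((\<lambda>t. r t * r x) \<longlongrightarrow> r x * r x) (at x)" by (simp add: isCont_def)
    then have "eventually (\<lambda>t. 0 < r t * r x) (at x)" using rx by (rule order_tendstoD(1))
    then obtain d where d: "0 < d" "\<And>t. t \<noteq> x \<Longrightarrow> dist t x < d \<Longrightarrow> 0 < r t * r x"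
      by (auto simp: eventually_at)
    define k where "k = min d e / 2"
    have k: "0 < k" "k < d" "k < e" using d(1) e by (auto simp: k_def)
    \<comment> \<open>On this side of \<open>x\<close> the factor \<open>t - x\<close> has the sign
      opposite to \<open>r x\<close>, while \<open>r t\<close> still has the sign of
      \<open>r x\<close>.\<close>
    define t where "t = x - k * sgn (r x)"
    have rx0: "r x \<noteq> 0" using rx by auto
    have tx: "\<bar>t - x\<bar> = k" using k rx0 by (simp add: t_def abs_mult abs_sgn_eq)
    have pos: "0 < r t * r x" using d(2)[of t] tx k by (auto simp: dist_real_def)
    have "poly g t / poly q t = (t - x) * r t" by (simp add: h r_def algebra_simps)
    also have "\<dots> = - k * (sgn (r x) * r t)" by (simp add: t_def)
    also have "sgn (r x) = sgn (r t)" using pos by (auto simp: zero_less_mult_iff)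
    finally have "poly g t / poly q t = - k * \<bar>r t\<bar>" by (simp add: mult_sgn_abs abs_sgn mult.commute)
    moreover have "0 < \<bar>r t\<bar>" using pos by auto
    ultimately have "poly g t / poly q t < 0" using k(1) by simp
    then show False using nn[of t] tx k by simp
  qed
  then obtain h' where "h = [:-x, 1:] * h'" by (auto simp: poly_eq_0_iff_dvd elim: dvdE)
  then have "g = [:-x, 1:]^2 * h'" using h by (simp only: power2_eq_square mult.assoc)
  then show ?thesis by simp
qed

text \<open>The derivative \<open>1 + (\<Sum>z\<in>Z. 1 / (t - z)^2)\<close> is positive, and the
  absolute value tends to infinity at \<open>Z\<close> and at infinity. So the sublevel sets of
  \<open>\<bar>rho Z t\<bar>\<close> exhaust the line without the poles by compact sets with few
  boundary points.\<close>

definition rho :: "real set \<Rightarrow> real \<Rightarrow> real" where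
  "rho Z t = t - (\<Sum>z\<in>Z. 1 / (t - z))"

text \<open>The numerator of \<open>rho Z t - a\<close> over the denominator
  \<open>\<Prod>z\<in>Z. t - z\<close>.\<close>

definition level_poly :: "real set \<Rightarrow> real \<Rightarrow> real poly" where
  "level_poly Z a = [:-a, 1:] * (\<Prod>z\<in>Z. [:-z, 1:]) - (\<Sum>z\<in>Z. \<Prod>u\<in>Z-{z}. [:-u, 1:])"

lemma poly_level_poly:
  assumes "finite Z" "t \<notin> Z"
  shows "poly (level_poly Z a) t = (rho Z t - a) * (\<Prod>z\<in>Z. t - z)"
proof -
  have "(\<Prod>u\<in>Z-{z}. t - u) = (\<Prod>z\<in>Z. t - z) / (t - z)" if "z \<in> Z" for z
    using assms that by (subst prod.remove[of Z z]) auto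
  then have "(\<Sum>z\<in>Z. \<Prod>u\<in>Z-{z}. t - u) = (\<Sum>z\<in>Z. 1 / (t - z)) * (\<Prod>z\<in>Z. t - z)"
    by (simp add: sum_distrib_right)
  then show ?thesis
    by (simp add: level_poly_def rho_def poly_prod poly_sum algebra_simps)
qed

text \<open>At a pole only the product that omits this pole survives.\<close>

lemma poly_level_poly_pole:
  assumes "finite Z" "z \<in> Z"
  shows "poly (level_poly Z a) z \<noteq> 0"
proof -
  have "(\<Sum>y\<in>Z. \<Prod>u\<in>Z-{y}. z - u) = (\<Sum>y\<in>Z. if y = z then (\<Prod>u\<in>Z-{z}. z - u) else 0)"
    using assms by (intro sum.cong) auto
  also have "\<dots> = (\<Prod>u\<in>Z-{z}. z - u)" using assms by simp
  finally have "(\<Sum>y\<in>Z. \<Prod>u\<in>Z-{y}. z - u) \<noteq> 0" using assms by auto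
  moreover have "(\<Prod>y\<in>Z. z - y) = 0" using assms by auto
  ultimately show ?thesis by (simp add: level_poly_def poly_prod poly_sum)
qed

text \<open>The points are roots of \<open>level_poly\<close>, whose degree is
  \<open>card Z + 1\<close> because the subtracted sum has lower degree.\<close>

lemma card_rho_level:
  assumes "finite Z"
  shows "finite {t. t \<notin> Z \<and> rho Z t = a}" "card {t. t \<notin> Z \<and> rho Z t = a} \<le> card Z + 1"
proof -
  have dp: "degree (\<Prod>z\<in>Y. [:-z, 1::real:]) = card Y" for Y
    by (subst degree_prod_sum_eq) auto
  define P where "P = [:-a, 1:] * (\<Prod>z\<in>Z. [:-z, 1:])"
  define S where "S = (\<Sum>z\<in>Z. \<Prod>u\<in>Z-{z}. [:-u, 1::real:])"
  have "degree P = card Z + 1"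
    unfolding P_def using assms by (subst degree_mult_eq) (auto simp: dp)
  moreover have "degree S \<le> card Z"
    unfolding S_def using assms by (intro degree_sum_le) (auto simp: dp card_Diff_subset)
  ultimately have "degree (P + - S) = card Z + 1"
    by (subst degree_add_eq_left) auto
  then have deg: "degree (level_poly Z a) = card Z + 1"
    by (simp add: level_poly_def P_def S_def)
  then have n0: "level_poly Z a \<noteq> 0" by auto
  have sub: "{t. t \<notin> Z \<and> rho Z t = a} \<subseteq> {t. poly (level_poly Z a) t = 0}"
    using poly_level_poly[OF assms] by auto
  show "finite {t. t \<notin> Z \<and> rho Z t = a}" by (rule finite_subset[OF sub poly_roots_finite[OF n0]])
  show "card {t. t \<notin> Z \<and> rho Z t = a} \<le> card Z + 1"
    using card_mono[OF poly_roots_finite[OF n0] sub] card_poly_roots_bound[OF n0] deg by linarith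
qed

lemma compact_rho_sublevel:
  assumes "finite Z"
  shows "compact {t. t \<notin> Z \<and> \<bar>rho Z t\<bar> \<le> l}"
proof -
  \<comment> \<open>Multiplied by the denominator, the inequality is one between continuous
    functions, and it fails at the poles by itself; this gives closedness.\<close>
  have eq: "{t. t \<notin> Z \<and> \<bar>rho Z t\<bar> \<le> l} = {t. \<bar>poly (level_poly Z 0) t\<bar> \<le> l * \<bar>\<Prod>z\<in>Z. t - z\<bar>}" (is "?S = _")
  proof -
    have "(t \<notin> Z \<and> \<bar>rho Z t\<bar> \<le> l) \<longleftrightarrow> \<bar>poly (level_poly Z 0) t\<bar> \<le> l * \<bar>\<Prod>z\<in>Z. t - z\<bar>" for t
    proof (cases "t \<in> Z")
      case True
      then have "(\<Prod>z\<in>Z. t - z) = 0" using assms by auto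
      then show ?thesis using True poly_level_poly_pole[OF assms True, of 0] by simp
    next
      case False
      then have "0 < \<bar>\<Prod>z\<in>Z. t - z\<bar>" using assms by auto
      then show ?thesis using False by (simp add: poly_level_poly[OF assms False] abs_mult)
    qed
    then show ?thesis by blast
  qed
  have "closed ?S" unfolding eq
    by (intro closed_Collect_le continuous_intros)
  moreover have "bounded ?S"
  proof -
    obtain c where c: "\<And>z. z \<in> Z \<Longrightarrow> \<bar>z\<bar> \<le> c"
      using finite_imp_bounded[OF assms] by (auto simp: bounded_iff)
    \<comment> \<open>Beyond \<open>c + 1\<close> all poles are more than 1 away, so
      \<open>rho Z t\<close> differs from \<open>t\<close> by at most \<open>card Z\<close>.\<close>
    have "\<bar>t\<bar> \<le> max (c + 1) (l + card Z)" if "t \<in> ?S" for t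
    proof (cases "\<bar>t\<bar> \<le> c + 1")
      case False
      have "\<bar>1 / (t - z)\<bar> \<le> 1" if "z \<in> Z" for z
        using c[OF that] False by (auto simp: field_simps abs_if split: if_splits)
      then have "(\<Sum>z\<in>Z. \<bar>1 / (t - z)\<bar>) \<le> real (card Z)"
        using sum_mono[of Z "\<lambda>z. \<bar>1 / (t - z)\<bar>" "\<lambda>_. 1"] by simp
      then have "\<bar>\<Sum>z\<in>Z. 1 / (t - z)\<bar> \<le> real (card Z)"
        using sum_abs[of "\<lambda>z. 1 / (t - z)" Z] by linarith
      then show ?thesis using \<open>t \<in> ?S\<close> by (auto simp: rho_def)
    qed auto
    then show ?thesis unfolding bounded_iff by (auto intro!: exI[of _ "max (c + 1) (l + card Z)"])
  qed
  ultimately show ?thesis by (simp add: compact_eq_bounded_closed)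
qed

lemma isCont_rho:
  assumes "finite Z" "t \<notin> Z"
  shows "isCont (rho Z) t"
  unfolding rho_def using assms by (intro continuous_intros) auto

lemma rho_increasing:
  assumes "finite Z" "t \<notin> Z"
  shows "\<exists>d>0. \<forall>h>0. h < d \<longrightarrow> rho Z (t - h) < rho Z t \<and> rho Z t < rho Z (t + h)"
proof -
  have "(rho Z has_real_derivative 1 - (\<Sum>z\<in>Z. - (1 / (t - z)^2))) (at t)"
    unfolding rho_def using assms
    by (auto intro!: derivative_eq_intros simp: power2_eq_square divide_simps)
  moreover have "0 < 1 - (\<Sum>z\<in>Z. - (1 / (t - z)^2))"
  proof -
    have "0 \<le> (\<Sum>z\<in>Z. 1 / (t - z)^2)" by (intro sum_nonneg) auto
    then show ?thesis by (simp add: sum_negf)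
  qed
  ultimately obtain d1 d2 where d: "0 < d1" "0 < d2"
    "\<And>h. 0 < h \<Longrightarrow> h < d1 \<Longrightarrow> rho Z (t - h) < rho Z t"
    "\<And>h. 0 < h \<Longrightarrow> h < d2 \<Longrightarrow> rho Z t < rho Z (t + h)"
    using DERIV_pos_inc_left DERIV_pos_inc_right by metis
  then show ?thesis by (intro exI[of _ "min d1 d2"]) auto
qed

section \<open>Representations by rational functions of one parameter\<close>

text \<open>Adding the first two bounds gives \<open>2 * (a + b + e) \<le> g + 2 * z + 2\<close>.
  Here \<open>a\<close> stands for the nonreal nodes, \<open>b\<close> for the real nodes below the
  level, \<open>e\<close> for those on it and \<open>z\<close> for the poles.\<close>

lemma node_count:
  fixes a b e g z x m :: nat
  assumes "2 * a + 2 * b + e \<le> g" "e \<le> 2 * z + 2" "x \<le> a + b + e" "g \<le> m"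
  shows "x \<le> m div 2 + z + 1"
  using assms by presburger

text \<open>The curve seen from its parameter: \<open>num i / q\<close> is the pullback of a
  monomial, and \<open>J\<close> holds nonreal parameters of real points, taken in the upper half
  plane so that conjugates are not counted. The index \<open>k0\<close> provides the constant
  function 1, whose moment is the total mass.\<close>

locale rational_family =
  fixes A :: "'i set" and num :: "'i \<Rightarrow> real poly" and q :: "real poly" and m :: nat
    and J :: "complex set" and k0 :: 'i
  assumes finA: "finite A" and q0: "q \<noteq> 0" and deg: "\<And>i. i \<in> A \<Longrightarrow> degree (num i) \<le> m"
    and finJ: "finite J" and Jim: "\<And>z. z \<in> J \<Longrightarrow> 0 < Im z"
    and Jq: "\<And>z. z \<in> J \<Longrightarrow> poly (cpoly q) z \<noteq> 0"
    and Jreal: "\<And>z i. z \<in> J \<Longrightarrow> i \<in> A \<Longrightarrow> poly (cpoly (num i)) z / poly (cpoly q) z \<in> \<real>"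
    and one: "k0 \<in> A" "num k0 = q"
begin

definition val :: "'i \<Rightarrow> complex \<Rightarrow> real" where
  "val i z = Re (poly (cpoly (num i)) z / poly (cpoly q) z)"

definition Z :: "real set" where "Z = {t. poly q t = 0}"

definition T :: "complex set" where "T = complex_of_real ` (- Z) \<union> J"

definition numer :: "'i set \<Rightarrow> ('i \<Rightarrow> real) \<Rightarrow> real poly" where
  "numer B c = (\<Sum>i\<in>B. smult (c i) (num i))"

text \<open>Points of \<open>J\<close> get the lowest level, so that they belong to every sublevel set.\<close>

definition lev :: "complex \<Rightarrow> real" where
  "lev z = (if Im z = 0 then \<bar>rho Z (Re z)\<bar> else 0)"

definition sublevel :: "real \<Rightarrow> complex set" where
  "sublevel l = {z\<in>T. lev z \<le> l}"

section \<open>Evaluation of pullbacks and sublevel sets of the parameter space\<close>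

lemma finZ: "finite Z" unfolding Z_def by (rule poly_roots_finite[OF q0])

lemma q_nz: "z \<in> T \<Longrightarrow> poly (cpoly q) z \<noteq> 0"
  using Jq by (auto simp: T_def Z_def)

lemma poly_num:
  assumes "z \<in> T" "i \<in> A"
  shows "poly (cpoly (num i)) z = of_real (val i z) * poly (cpoly q) z"
proof -
  have "poly (cpoly (num i)) z / poly (cpoly q) z \<in> \<real>"
    using assms Jreal by (auto simp: T_def)
  then have "poly (cpoly (num i)) z / poly (cpoly q) z = of_real (val i z)"
    by (simp add: val_def)
  then show ?thesis using q_nz[OF assms(1)] by (simp add: divide_eq_eq)
qed

lemma poly_numer:
  assumes "B \<subseteq> A" "z \<in> T"
  shows "poly (cpoly (numer B c)) z = of_real (\<Sum>i\<in>B. c i * val i z) * poly (cpoly q) z"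
proof -
  have "poly (cpoly (numer B c)) z = (\<Sum>i\<in>B. of_real (c i) * poly (cpoly (num i)) z)"
    by (simp add: numer_def cpoly_sum cpoly_smult poly_sum)
  also have "\<dots> = (\<Sum>i\<in>B. of_real (c i * val i z) * poly (cpoly q) z)"
    using assms by (intro sum.cong refl) (auto simp: poly_num)
  finally show ?thesis by (simp add: sum_distrib_right)
qed

lemma numer_zero_iff:
  assumes "B \<subseteq> A" "z \<in> T"
  shows "poly (cpoly (numer B c)) z = 0 \<longleftrightarrow> (\<Sum>i\<in>B. c i * val i z) = 0"
  using poly_numer[OF assms] q_nz[OF assms(2)] by (simp del: of_real_sum)

lemma numer_real:
  assumes "B \<subseteq> A" "t \<notin> Z"
  shows "poly (numer B c) t / poly q t = (\<Sum>i\<in>B. c i * val i (of_real t))"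
proof -
  have "of_real t \<in> T" using assms by (auto simp: T_def)
  from poly_numer[OF assms(1) this, of c]
  have "complex_of_real (poly (numer B c) t) = of_real ((\<Sum>i\<in>B. c i * val i (of_real t)) * poly q t)"
    by simp
  then have "poly (numer B c) t = (\<Sum>i\<in>B. c i * val i (of_real t)) * poly q t"
    by (simp only: of_real_eq_iff)
  then show ?thesis using assms(2) by (simp add: Z_def)
qed

lemma degree_numer: "B \<subseteq> A \<Longrightarrow> degree (numer B c) \<le> m"
  unfolding numer_def using deg finA
  by (intro degree_sum_le) (auto intro: finite_subset order_trans[OF degree_smult_le])

lemma val_k0: "z \<in> T \<Longrightarrow> val k0 z = 1"
  using q_nz by (simp add: val_def one)

lemma continuous_val: "continuous_on T (val i)"
  unfolding val_def using q_nz by (intro continuous_intros) auto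

lemma sublevel_eq: "0 \<le> l \<Longrightarrow> sublevel l = complex_of_real ` {t. t \<notin> Z \<and> \<bar>rho Z t\<bar> \<le> l} \<union> J"
  using Jim by (force simp: sublevel_def T_def lev_def image_iff)

lemma sublevel_subset: "sublevel l \<subseteq> T"
  by (auto simp: sublevel_def)

lemma compact_real_sublevel: "compact (complex_of_real ` {t. t \<notin> Z \<and> \<bar>rho Z t\<bar> \<le> l})"
  by (intro compact_continuous_image compact_rho_sublevel finZ continuous_intros)

lemma compact_sublevel: "0 \<le> l \<Longrightarrow> compact (sublevel l)"
  unfolding sublevel_eq using finJ
  by (intro compact_Un compact_real_sublevel finite_imp_compact)

lemma continuous_lev:
  assumes "0 \<le> l"
  shows "continuous_on (sublevel l) lev"
  unfolding sublevel_eq[OF assms]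
proof (intro continuous_on_closed_Un compact_imp_closed compact_real_sublevel finite_imp_compact finJ)
  let ?S = "{t. t \<notin> Z \<and> \<bar>rho Z t\<bar> \<le> l}"
  have 1: "continuous_on ?S (rho Z)"
    using isCont_rho[OF finZ] by (intro continuous_at_imp_continuous_on) auto
  have "continuous_on (complex_of_real ` ?S) (\<lambda>z. \<bar>rho Z (Re z)\<bar>)"
    by (intro continuous_intros continuous_on_compose2[OF 1]) auto
  then show "continuous_on (complex_of_real ` ?S) lev"
    by (rule continuous_on_eq) (auto simp: lev_def)
  show "continuous_on J lev"
    using continuous_on_finite[OF finJ] .
qed

section \<open>Existence of a representation of least level\<close>

lemma conic_rep_total:
  assumes "conic_rep val A T y X w"
  shows "y k0 = sum w X"
proof -
  have "y k0 = (\<Sum>x\<in>X. w x * val k0 x)" using assms one(1) by (auto simp: conic_rep_def)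
  also have "\<dots> = sum w X"
    using assms val_k0 by (intro sum.cong) (auto simp: conic_rep_def)
  finally show ?thesis .
qed

text \<open>Representations coded as points of a compact space: a level bound and a sequence of
  pairs of node and weight, of which only the first \<open>card A\<close> count. Weights may be zero
  and are bounded by the total mass \<open>y k0\<close>.\<close>

definition configs :: "('i \<Rightarrow> real) \<Rightarrow> real \<Rightarrow> (real \<times> (nat \<Rightarrow> complex \<times> real)) set" where
  "configs y l0 = {x \<in> {0..l0} \<times> (UNIV \<rightarrow> sublevel l0 \<times> {0..y k0}).
     (\<forall>j<card A. lev (fst (snd x j)) \<le> fst x) \<and>
     (\<forall>i\<in>A. (\<Sum>j<card A. snd (snd x j) * val i (fst (snd x j))) = y i)}"

text \<open>The surrounding box is compact by Tychonoff's theorem. Continuity of \<open>lev\<close>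
  is known only on sublevel sets and that of \<open>val\<close> only on \<open>T\<close>, so the
  other conditions are shown to be closed inside the box.\<close>

lemma compact_configs:
  assumes "0 \<le> l0"
  shows "compact (configs y l0)"
proof -
  let ?O = "{0..l0} \<times> (UNIV \<rightarrow> sublevel l0 \<times> {0..y k0}) :: (real \<times> (nat \<Rightarrow> complex \<times> real)) set"
  have "compactin (product_topology (\<lambda>i::nat. euclidean) UNIV) (PiE UNIV (\<lambda>_. sublevel l0 \<times> {0..y k0}))"
    using assms by (subst compactin_PiE) (auto intro: compact_Times compact_sublevel)
  then have "compact (UNIV \<rightarrow> sublevel l0 \<times> {0..y k0} :: (nat \<Rightarrow> complex \<times> real) set)"
    by (simp add: euclidean_product_topology PiE_def)
  then have cO: "compact ?O" by (intro compact_Times) auto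
  then have clO: "closed ?O" by (rule compact_imp_closed)
  have c0: "continuous_on ?O (\<lambda>x. snd x j)" for j
    by (rule continuous_on_product_then_coordinatewise[OF continuous_on_snd[OF continuous_on_id]])
  note c1 = continuous_on_fst[OF c0] continuous_on_snd[OF c0]
  have c2: "continuous_on ?O (\<lambda>x. lev (fst (snd x j)))" for j
    by (rule continuous_on_compose2[OF continuous_lev[OF assms] c1(1)]) (auto simp: Pi_iff mem_Times_iff)
  have c3: "continuous_on ?O (\<lambda>x. val i (fst (snd x j)))" for i j
    by (rule continuous_on_compose2[OF continuous_on_subset[OF continuous_val sublevel_subset] c1(1)])
      (auto simp: Pi_iff mem_Times_iff)
  have cl1: "closed {x\<in>?O. lev (fst (snd x j)) \<le> fst x}" for j
    by (intro continuous_on_closed_Collect_le c2 clO continuous_intros)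
  have cl2: "closed {x\<in>?O. (\<Sum>j<card A. snd (snd x j) * val i (fst (snd x j))) = y i}" for i
    by (rule continuous_closed_preimage_constant[OF _ clO]) (intro continuous_intros c1 c3)
  have "configs y l0 = ?O \<inter> (\<Inter>j<card A. {x\<in>?O. lev (fst (snd x j)) \<le> fst x})
    \<inter> (\<Inter>i\<in>A. {x\<in>?O. (\<Sum>j<card A. snd (snd x j) * val i (fst (snd x j))) = y i})"
    unfolding configs_def by auto
  then show ?thesis using cO cl1 cl2 by (auto intro!: compact_Int_closed closed_INT)
qed

lemma config_of_rep:
  assumes rep: "conic_rep val A (sublevel l) y X w" and "X \<noteq> {}" "0 \<le> l" "l \<le> l0"
  shows "\<exists>u. (l, u) \<in> configs y l0"
proof -
  obtain X w where rep: "conic_rep val A (sublevel l) y X w" and card: "card X \<le> card A" and ne: "X \<noteq> {}"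
  proof -
    obtain X' w' where X': "card X' \<le> card A" "conic_rep val A (sublevel l) y X' w'"
      using caratheodory_conic[OF finA rep] by blast
    have "y k0 \<noteq> 0"
    proof -
      have "0 < sum w X" using assms(1,2) by (intro sum_pos) (auto simp: conic_rep_def)
      moreover have "conic_rep val A T y X w"
        using sublevel_subset[of l] assms(1) by (intro conic_rep_mono[OF assms(1)]) (auto simp: conic_rep_def)
      ultimately show ?thesis using conic_rep_total by force
    qed
    then have "X' \<noteq> {}" using X'(2) one(1) by (auto simp: conic_rep_def)
    then show ?thesis using that X' by blast
  qed
  have X: "finite X" "X \<subseteq> sublevel l" "\<And>x. x \<in> X \<Longrightarrow> 0 < w x"
    "\<And>i. i \<in> A \<Longrightarrow> y i = (\<Sum>x\<in>X. w x * val i x)"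
    using rep by (auto simp: conic_rep_def)
  have tot: "y k0 = sum w X"
    using rep sublevel_subset[of l] by (intro conic_rep_total) (auto simp: conic_rep_def)
  obtain h where h: "bij_betw h {..<card X} X"
    using ex_bij_betw_nat_finite[OF X(1)] by (auto simp: atLeast0LessThan)
  have c0: "0 < card X" using ne X(1) by (simp add: card_gt_0_iff)
  have hX: "h j \<in> X" if "j < card X" for j using h that by (auto simp: bij_betw_def)
  define u where "u j = (if j < card X then (h j, w (h j)) else (h 0, 0))" for j
  have fX: "fst (u j) \<in> X" for j using hX c0 by (auto simp: u_def)
  have sub: "sublevel l \<subseteq> sublevel l0" using assms(4) by (auto simp: sublevel_def)
  have wle: "w x \<le> y k0" if "x \<in> X" for x
    unfolding tot using X(1,3) that by (intro member_le_sum) (auto intro: less_imp_le)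
  have wu: "snd (u j) \<in> {0..y k0}" for j
    using hX[of j] X(3)[of "h j"] wle[of "h j"] X(3) tot
    by (auto simp: u_def intro: less_imp_le sum_nonneg)
  have "u j \<in> sublevel l0 \<times> {0..y k0}" for j
    using fX[of j] wu[of j] X(2) sub by (cases "u j") auto
  moreover have "(\<Sum>j<card A. snd (u j) * val i (fst (u j))) = y i" if "i \<in> A" for i
  proof -
    have "(\<Sum>j<card A. snd (u j) * val i (fst (u j))) = (\<Sum>j<card X. snd (u j) * val i (fst (u j)))"
      using card by (intro sum.mono_neutral_right) (auto simp: u_def)
    also have "\<dots> = (\<Sum>j<card X. w (h j) * val i (h j))"
      by (intro sum.cong) (auto simp: u_def)
    also have "\<dots> = (\<Sum>x\<in>X. w x * val i x)"
      using sum.reindex_bij_betw[OF h, of "\<lambda>x. w x * val i x"] .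
    finally show ?thesis using X(4)[OF that] by simp
  qed
  moreover have "lev (fst (u j)) \<le> l" for j
    using fX[of j] X(2) by (auto simp: sublevel_def)
  ultimately show ?thesis
    using assms(3,4) by (intro exI[of _ u]) (auto simp: configs_def Pi_iff)
qed

lemma rep_of_config:
  assumes "(l, u) \<in> configs y l0"
  shows "\<exists>X w. conic_rep val A (sublevel l) y X w"
proof -
  have *: "u j \<in> sublevel l0 \<times> {0..y k0}" for j using assms by (auto simp: configs_def)
  have "\<exists>v. conic_rep val A (sublevel l) y
      ((\<lambda>j. fst (u j)) ` {j\<in>{..<card A}. 0 < snd (u j)}) v"
  proof (rule conic_rep_family)
    show "0 \<le> snd (u j)" for j using *[of j] by auto
    show "fst (u j) \<in> sublevel l" if "j \<in> {..<card A}" for j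
      using assms that *[of j] by (auto simp: configs_def sublevel_def)
    show "y i = (\<Sum>j<card A. snd (u j) * val i (fst (u j)))" if "i \<in> A" for i
      using assms that by (auto simp: configs_def)
  qed simp
  then show ?thesis by blast
qed

text \<open>The level bound attains its minimum on the compact set of configurations, and a
  representation of lower level would give a configuration below this minimum.\<close>

lemma minimal_level:
  assumes "conic_rep val A T y X0 w0"
  shows "\<exists>l\<ge>0. (\<exists>X w. conic_rep val A (sublevel l) y X w) \<and>
    (\<forall>l'. 0 \<le> l' \<longrightarrow> l' < l \<longrightarrow> (\<nexists>X w. conic_rep val A (sublevel l') y X w))"
proof (cases "X0 = {}")
  case True
  then have "conic_rep val A (sublevel 0) y {} w0" using assms by (auto simp: conic_rep_def)
  then show ?thesis by (intro exI[of _ 0]) auto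
next
  case False
  have fX0: "finite X0" "X0 \<subseteq> T" using assms by (auto simp: conic_rep_def)
  define l0 where "l0 = Max (insert 0 (lev ` X0))"
  have l0: "0 \<le> l0" "\<And>x. x \<in> X0 \<Longrightarrow> lev x \<le> l0" using fX0 by (auto simp: l0_def)
  have rep0: "conic_rep val A (sublevel l0) y X0 w0"
    using fX0 l0 by (intro conic_rep_mono[OF assms]) (auto simp: sublevel_def)
  have "configs y l0 \<noteq> {}" using config_of_rep[OF rep0 False l0(1)] by auto
  moreover have "continuous_on (configs y l0) fst" by (intro continuous_intros)
  ultimately obtain x where x: "x \<in> configs y l0" "\<And>x'. x' \<in> configs y l0 \<Longrightarrow> fst x \<le> fst x'"
    using continuous_attains_inf[OF compact_configs[OF l0(1)]] by blast
  obtain l u where lu: "x = (l, u)" by (cases x)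
  have yk: "y k0 \<noteq> 0"
  proof -
    have "0 < sum w0 X0" using assms False by (intro sum_pos) (auto simp: conic_rep_def)
    then show ?thesis using conic_rep_total[OF assms] by simp
  qed
  have "\<not> conic_rep val A (sublevel l') y X w" if l': "0 \<le> l'" "l' < l" for l' X w
  proof
    assume r: "conic_rep val A (sublevel l') y X w"
    have "X \<noteq> {}" using r yk one(1) by (auto simp: conic_rep_def)
    moreover have "l' \<le> l0" using l' x(1) lu by (auto simp: configs_def)
    ultimately obtain u' where "(l', u') \<in> configs y l0" using config_of_rep[OF r _ l'(1)] by blast
    from x(2)[OF this] show False using that lu by simp
  qed
  moreover have "0 \<le> l" using x(1) lu by (auto simp: configs_def)
  ultimately show ?thesis using rep_of_config[of l u y l0] x(1) lu by blast
qed

section \<open>The node bound for a rational family\<close>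

lemma level_approx:
  assumes t: "t \<notin> Z" and l: "0 < \<bar>rho Z t\<bar>" and e: "0 < e"
  shows "\<exists>s. s \<notin> Z \<and> \<bar>s - t\<bar> < e \<and> \<bar>rho Z s\<bar> < \<bar>rho Z t\<bar>"
proof -
  obtain d where d: "0 < d" "\<And>h. 0 < h \<Longrightarrow> h < d \<Longrightarrow> rho Z (t - h) < rho Z t \<and> rho Z t < rho Z (t + h)"
    using rho_increasing[OF finZ t] by blast
  have "(rho Z \<longlongrightarrow> rho Z t) (at t)" using isCont_rho[OF finZ t] by (simp add: isCont_def)
  \<comment> \<open>This closeness preserves the sign of \<open>rho\<close>, so a small step to the
    left where \<open>rho\<close> is positive, or to the right where it is negative, lowers the
    absolute value.\<close>
  then have "eventually (\<lambda>s. dist (rho Z s) (rho Z t) < \<bar>rho Z t\<bar>) (at t)"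
    using l by (rule tendstoD)
  moreover have "eventually (\<lambda>s. s \<notin> Z) (at t)"
    using finite_imp_closed[OF finZ] t by (intro eventually_at_in_open'[of "- Z", simplified]) auto
  ultimately have "eventually (\<lambda>s. dist (rho Z s) (rho Z t) < \<bar>rho Z t\<bar> \<and> s \<notin> Z) (at t)"
    by eventually_elim auto
  then obtain r where r: "0 < r" "\<And>s. s \<noteq> t \<Longrightarrow> dist s t < r \<Longrightarrow>
      dist (rho Z s) (rho Z t) < \<bar>rho Z t\<bar> \<and> s \<notin> Z"
    by (auto simp: eventually_at)
  define h where "h = min (min d r) e / 2"
  have h: "0 < h" "h < d" "h < r" "h < e" using d(1) r(1) e by (auto simp: h_def)
  show ?thesis
  proof (cases "0 < rho Z t")
    case True
    show ?thesis
      using d(2)[OF h(1,2)] r(2)[of "t - h"] h True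
      by (intro exI[of _ "t - h"]) (auto simp: dist_real_def)
  next
    case False
    show ?thesis
      using d(2)[OF h(1,2)] r(2)[of "t + h"] h False l
      by (intro exI[of _ "t + h"]) (auto simp: dist_real_def)
  qed
qed

lemma few_nodes:
  assumes rep: "conic_rep val A T y X0 w0"
  shows "\<exists>X w. conic_rep val A T y X w \<and> card X \<le> m div 2 + card Z + 1"
proof -
  \<comment> \<open>Independence on \<open>T\<close> guarantees that nontrivial coefficients on
    \<open>B\<close> have a nonzero numerator, to which the root count applies.\<close>
  obtain B where B: "spanning val A T B"
    and indep: "\<And>c. (\<And>x. x \<in> T \<Longrightarrow> (\<Sum>j\<in>B. c j * val j x) = 0) \<Longrightarrow> (\<forall>j\<in>B. c j = 0)"
    using basis_exists[OF finA, of val T] by blast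
  have BA: "B \<subseteq> A" and finB: "finite B"
    using B finA by (auto simp: spanning_def intro: finite_subset)
  have numer0: "numer B c \<noteq> 0" if "k \<in> B" "c k \<noteq> 0" for c k
  proof
    assume "numer B c = 0"
    then have "(\<Sum>j\<in>B. c j * val j x) = 0" if "x \<in> T" for x
      using numer_zero_iff[OF BA that, of c] by simp
    then show False using indep[of c] that by blast
  qed
  have repB: "conic_rep val B T y X w" if "conic_rep val A T y X w" for X w
    using that BA by (auto simp: conic_rep_def)
  show ?thesis
  proof (cases "m div 2 + 1 \<le> card J")
    case True
    then obtain J' where J': "J' \<subseteq> J" "card J' = m div 2 + 1" "finite J'"
      using obtain_subset_with_card_n[OF True] finJ by (metis finite_subset)
    \<comment> \<open>A nontrivial combination vanishing on \<open>J'\<close> would have a numerator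
      with at least \<open>2 * (m div 2 + 1) > m\<close> roots.\<close>
    have "card B \<le> card J'"
    proof (rule ccontr)
      assume "\<not> card B \<le> card J'"
      then obtain c k where c: "k \<in> B" "c k \<noteq> 0" "\<forall>z\<in>J'. (\<Sum>j\<in>B. c j * val j z) = 0"
        using homogeneous_system[OF J'(3) finB, of "\<lambda>z j. val j z"] by auto
      have "2 * card J' + 2 * card ({}::real set) + card ({}::real set) \<le> degree (numer B c)"
      proof (rule root_count)
        show "numer B c \<noteq> 0" using numer0 c by blast
        show "0 < Im z \<and> poly (cpoly (numer B c)) z = 0" if "z \<in> J'" for z
          using that J'(1) c(3) Jim numer_zero_iff[OF BA, of z c] by (auto simp: T_def)
      qed (use J' in auto)
      then show False using J'(2) degree_numer[OF BA, of c] by simp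
    qed
    obtain X w where X: "card X \<le> card B" "conic_rep val B T y X w"
      using caratheodory_conic[OF finB repB[OF rep]] by blast
    have "conic_rep val A T y X w" by (rule conic_rep_spanning[OF B rep X(2)])
    moreover have "card X \<le> m div 2 + card Z + 1"
      using X(1) \<open>card B \<le> card J'\<close> J'(2) by linarith
    ultimately show ?thesis by blast
  next
    case False
    obtain l X w where l: "0 \<le> l" and X: "conic_rep val A (sublevel l) y X w"
      and min: "\<And>l' X w. 0 \<le> l' \<Longrightarrow> l' < l \<Longrightarrow> \<not> conic_rep val A (sublevel l') y X w"
      using minimal_level[OF rep] by blast
    have XT: "X \<subseteq> T" and finX: "finite X" and Xl: "\<And>x. x \<in> X \<Longrightarrow> lev x \<le> l"
      using X by (auto simp: conic_rep_def sublevel_def)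
    have repX: "conic_rep val A T y X w" using conic_rep_mono[OF X XT] .
    \<comment> \<open>\<open>R\<close> collects the real nodes strictly below the least level and
      \<open>E\<close> those exactly on it; they count as double and as simple roots.\<close>
    define R where "R = {t. of_real t \<in> X \<and> \<bar>rho Z t\<bar> < l}"
    define E where "E = {t. of_real t \<in> X \<and> \<bar>rho Z t\<bar> = l}"
    have TZ: "t \<notin> Z" if "complex_of_real t \<in> T" for t
      using that Jim by (force simp: T_def)
    have levr: "lev (of_real t) = \<bar>rho Z t\<bar>" for t by (simp add: lev_def)
    have Xeq: "X = (X \<inter> J) \<union> complex_of_real ` R \<union> complex_of_real ` E"
    proof -
      have "x \<in> complex_of_real ` R \<union> complex_of_real ` E" if x: "x \<in> X" "x \<notin> J" for x
      proof -
        obtain t where "x = of_real t" using XT x by (auto simp: T_def)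
        then show ?thesis using x Xl[of x] levr[of t] by (force simp: R_def E_def)
      qed
      then show ?thesis by (auto simp: R_def E_def)
    qed
    have finRE: "finite R" "finite E"
      using finite_vimageI[OF finX, of complex_of_real]
      by (auto simp: R_def E_def vimage_def inj_def elim!: finite_subset[rotated])
    have cardX: "card X \<le> card (X \<inter> J) + card R + card E"
    proof -
      have "card X \<le> card (X \<inter> J) + card (complex_of_real ` R) + card (complex_of_real ` E)"
        by (subst Xeq) (meson add_le_mono1 card_Un_le order_trans)
      then show ?thesis by (simp add: card_image inj_on_def)
    qed
    show ?thesis
    proof (cases "l = 0")
      case True
      have "E \<subseteq> {t. t \<notin> Z \<and> rho Z t = 0}" using True TZ XT by (auto simp: E_def)
      then have "card E \<le> card Z + 1"
        using card_rho_level[OF finZ, of 0] card_mono order_trans by blast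
      moreover have "R = {}" using True by (auto simp: R_def)
      moreover have "card (X \<inter> J) \<le> card J" using finJ by (intro card_mono) auto
      ultimately have "card X \<le> m div 2 + card Z + 1" using cardX False by simp
      then show ?thesis using repX by blast
    next
      case l_pos: False
      define S where "S = {z\<in>T. lev z < l}"
      \<comment> \<open>Finitely many nodes of level below \<open>l\<close> have a largest level,
        which is still below \<open>l\<close>; this contradicts minimality.\<close>
      have "\<not> conic_rep val B S y X' w'" for X' w'
      proof
        assume r: "conic_rep val B S y X' w'"
        have X': "finite X'" "X' \<subseteq> S" using r by (auto simp: conic_rep_def)
        define l' where "l' = Max (insert 0 (lev ` X'))"
        have l': "0 \<le> l'" "\<And>x. x \<in> X' \<Longrightarrow> lev x \<le> l'" using X' by (auto simp: l'_def)
        have "l' < l" using X' l l_pos by (auto simp: l'_def S_def)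
        have ST: "X' \<subseteq> T" using X' by (auto simp: S_def)
        have "conic_rep val A T y X' w'"
          by (rule conic_rep_spanning[OF B rep conic_rep_mono[OF r ST]])
        then have "conic_rep val A (sublevel l') y X' w'"
          by (rule conic_rep_mono) (use ST l' in \<open>auto simp: sublevel_def\<close>)
        then show False using min[OF l'(1) \<open>l' < l\<close>] by blast
      qed
      then obtain c k where c: "k \<in> B" "c k \<noteq> 0"
        "\<And>z. z \<in> S \<Longrightarrow> 0 \<le> (\<Sum>i\<in>B. c i * val i z)" "(\<Sum>i\<in>B. c i * y i) \<le> 0"
        using conic_separation[OF finB, of val S y] by blast
      let ?f = "\<lambda>z. \<Sum>i\<in>B. c i * val i z"
      let ?g = "numer B c"
      have JS: "J \<subseteq> S" using l l_pos Jim by (force simp: S_def T_def lev_def)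
      have cont: "isCont (\<lambda>t. poly ?g t / poly q t) t" if "t \<notin> Z" for t
        using that by (intro continuous_intros) (auto simp: Z_def)
      \<comment> \<open>Points of \<open>E\<close> are limits of points of \<open>S\<close>, because
        \<open>\<bar>rho Z t\<bar>\<close> can be lowered by an arbitrarily small move;
        nonnegativity passes to the limit.\<close>
      have nnE: "0 \<le> poly ?g t / poly q t" if "t \<in> E" for t
      proof (rule ccontr)
        assume neg: "\<not> 0 \<le> poly ?g t / poly q t"
        have tZ: "t \<notin> Z" using that TZ XT by (auto simp: E_def)
        have "((\<lambda>t. poly ?g t / poly q t) \<longlongrightarrow> poly ?g t / poly q t) (at t)"
          using cont[OF tZ] by (simp add: isCont_def)
        then have "eventually (\<lambda>t. poly ?g t / poly q t < 0) (at t)"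
          using neg by (intro order_tendstoD(2)) auto
        then obtain e where e: "0 < e" "\<And>s. s \<noteq> t \<Longrightarrow> dist s t < e \<Longrightarrow> poly ?g s / poly q s < 0"
          by (auto simp: eventually_at)
        have lt: "\<bar>rho Z t\<bar> = l" using that by (simp add: E_def)
        then obtain s where s: "s \<notin> Z" "\<bar>s - t\<bar> < e" "\<bar>rho Z s\<bar> < \<bar>rho Z t\<bar>"
          using level_approx[OF tZ _ e(1)] l l_pos by auto
        have "of_real s \<in> S" using s lt levr[of s] by (auto simp: S_def T_def)
        then have "0 \<le> poly ?g s / poly q s" using c(3) numer_real[OF BA s(1)] by simp
        moreover have "s \<noteq> t" using s(3) by auto
        ultimately show False using e(2)[of s] s(2) by (auto simp: dist_real_def)
      qed
      have nn: "0 \<le> ?f x" if "x \<in> X" for x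
      proof (cases "x \<in> S")
        case True
        then show ?thesis by (rule c(3))
      next
        case False
        then have "x \<in> complex_of_real ` E"
          using that Xeq JS levr XT by (auto simp: R_def S_def)
        then obtain t where t: "t \<in> E" "x = of_real t" by blast
        then have "t \<notin> Z" using TZ XT by (auto simp: E_def)
        then show ?thesis using nnE[OF t(1)] numer_real[OF BA] t(2) by simp
      qed
      have wpos: "0 < w x" if "x \<in> X" for x using X that by (auto simp: conic_rep_def)
      have "(\<Sum>i\<in>B. c i * y i) = (\<Sum>i\<in>B. \<Sum>x\<in>X. w x * (c i * val i x))"
        using repB[OF repX] by (intro sum.cong) (auto simp: conic_rep_def sum_distrib_left algebra_simps)
      also have "\<dots> = (\<Sum>x\<in>X. w x * ?f x)"
        by (subst sum.swap) (simp add: sum_distrib_left)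
      finally have "(\<Sum>x\<in>X. w x * ?f x) \<le> 0" using c(4) by simp
      moreover have nn': "\<And>x. x \<in> X \<Longrightarrow> 0 \<le> w x * ?f x" using nn wpos by (simp add: less_imp_le)
      \<comment> \<open>A nonpositive sum of nonnegative terms: with positive weights, the
        separating function vanishes at every node.\<close>
      ultimately have "(\<Sum>x\<in>X. w x * ?f x) = 0" by (intro antisym sum_nonneg)
      then have "\<And>x. x \<in> X \<Longrightarrow> w x * ?f x = 0"
        using sum_nonneg_eq_0_iff[of X "\<lambda>x. w x * ?f x"] finX nn' by simp
      then have f0: "?f x = 0" if "x \<in> X" for x using wpos[OF that] that by fastforce
      have g0: "poly (cpoly ?g) x = 0" if "x \<in> X" for x
        using numer_zero_iff[OF BA, of x c] f0[OF that] XT that by auto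
      have g0r: "poly ?g t = 0" if "of_real t \<in> X" for t
        using g0[OF that] by simp
      have "2 * card (X \<inter> J) + 2 * card R + card E \<le> degree ?g"
      proof (rule root_count)
        show "?g \<noteq> 0" using numer0 c(1,2) by blast
        show "R \<inter> E = {}" by (auto simp: R_def E_def)
        show "0 < Im z \<and> poly (cpoly ?g) z = 0" if "z \<in> X \<inter> J" for z
          using that g0 Jim by auto
        show "poly ?g t = 0" if "t \<in> E" for t using that g0r by (auto simp: E_def)
        show "[:-t, 1:]^2 dvd ?g" if t: "t \<in> R" for t
        proof -
          have tZ: "t \<notin> Z" using t TZ XT by (auto simp: R_def)
          \<comment> \<open>A whole neighbourhood of \<open>t\<close> stays below the level, so the
            quotient is nonnegative on both sides of its zero.\<close>
          have "((\<lambda>s. \<bar>rho Z s\<bar>) \<longlongrightarrow> \<bar>rho Z t\<bar>) (at t)"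
            using isCont_rho[OF finZ tZ] by (intro tendsto_intros) (simp add: isCont_def)
          then have "eventually (\<lambda>s. \<bar>rho Z s\<bar> < l) (at t)"
            using t by (intro order_tendstoD(2)) (auto simp: R_def)
          moreover have "eventually (\<lambda>s. s \<notin> Z) (at t)"
            using finite_imp_closed[OF finZ] tZ
            by (intro eventually_at_in_open'[of "- Z", simplified]) auto
          ultimately have "eventually (\<lambda>s. \<bar>rho Z s\<bar> < l \<and> s \<notin> Z) (at t)"
            by eventually_elim auto
          then obtain e where e: "0 < e" "\<And>s. s \<noteq> t \<Longrightarrow> dist s t < e \<Longrightarrow> \<bar>rho Z s\<bar> < l \<and> s \<notin> Z"
            by (auto simp: eventually_at)
          show ?thesis
          proof (rule double_root[OF _ _ e(1)])
            show "poly ?g t = 0" using t g0r by (auto simp: R_def)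
            show "poly q t \<noteq> 0" using tZ by (simp add: Z_def)
            show "0 \<le> poly ?g s / poly q s" if "\<bar>s - t\<bar> < e" for s
            proof -
              have s: "\<bar>rho Z s\<bar> < l" "s \<notin> Z"
                using e(2)[of s] that t tZ by (cases "s = t"; auto simp: dist_real_def R_def)+
              then have "of_real s \<in> S" using levr[of s] by (auto simp: S_def T_def)
              then show ?thesis using c(3) numer_real[OF BA s(2)] by simp
            qed
          qed
        qed
      qed (use finX finRE in auto)
      moreover have "card E \<le> 2 * card Z + 2"
      proof -
        have "E \<subseteq> {t. t \<notin> Z \<and> rho Z t = l} \<union> {t. t \<notin> Z \<and> rho Z t = - l}"
          using TZ XT by (auto simp: E_def)
        then have "card E \<le> card ({t. t \<notin> Z \<and> rho Z t = l} \<union> {t. t \<notin> Z \<and> rho Z t = - l})"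
          using card_rho_level(1)[OF finZ] by (intro card_mono) auto
        also have "\<dots> \<le> card {t. t \<notin> Z \<and> rho Z t = l} + card {t. t \<notin> Z \<and> rho Z t = - l}"
          by (rule card_Un_le)
        also have "\<dots> \<le> (card Z + 1) + (card Z + 1)"
          by (intro add_mono card_rho_level(2) finZ)
        finally show ?thesis by simp
      qed
      ultimately have "card X \<le> m div 2 + card Z + 1"
        using node_count[OF _ _ cardX degree_numer[OF BA, of c]] by blast
      then show ?thesis using repX by blast
    qed
  qed
qed

end

section \<open>Points of the Zariski closure\<close>

lemma finite_multi_indices: "finite {\<alpha>::'n::finite \<Rightarrow> nat. (\<Sum>i\<in>UNIV. \<alpha> i) \<le> k}"
proof (rule finite_subset)
  show "{\<alpha>::'n \<Rightarrow> nat. (\<Sum>i\<in>UNIV. \<alpha> i) \<le> k} \<subseteq> PiE UNIV (\<lambda>_. {..k})"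
  proof
    fix \<alpha> :: "'n \<Rightarrow> nat" assume \<alpha>: "\<alpha> \<in> {\<alpha>. (\<Sum>i\<in>UNIV. \<alpha> i) \<le> k}"
    have "\<alpha> i \<le> (\<Sum>i\<in>UNIV. \<alpha> i)" for i by (rule member_le_sum) auto
    then show "\<alpha> \<in> PiE UNIV (\<lambda>_. {..k})" using \<alpha> by (auto intro: order_trans)
  qed
qed (intro finite_PiE; simp)

lemma mono_fun_in_poly_fun_le:
  fixes \<alpha> :: "'n::finite \<Rightarrow> nat"
  assumes "(\<Sum>i\<in>UNIV. \<alpha> i) \<le> k"
  shows "mono_fun \<alpha> \<in> (poly_fun_le k :: ('a::field ^ 'n \<Rightarrow> 'a) set)"
  unfolding poly_fun_le_def mem_Collect_eq
proof (intro exI allI)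
  show "mono_fun \<alpha> x = (\<Sum>\<beta> | (\<Sum>i\<in>UNIV. \<beta> i) \<le> k. (if \<beta> = \<alpha> then 1 else 0) * mono_fun \<beta> x)" for x :: "'a ^ 'n"
    using assms finite_multi_indices[where 'n = 'n, of k]
    by (simp add: if_distrib if_distribR cong: if_cong)
qed

lemma poly_fun_le_add:
  assumes "f \<in> poly_fun_le k" "g \<in> poly_fun_le k"
  shows "(\<lambda>x. f x + g x) \<in> poly_fun_le k"
proof -
  obtain c d where "\<And>x. f x = (\<Sum>\<alpha> | (\<Sum>i\<in>UNIV. \<alpha> i) \<le> k. c \<alpha> * mono_fun \<alpha> x)"
    "\<And>x. g x = (\<Sum>\<alpha> | (\<Sum>i\<in>UNIV. \<alpha> i) \<le> k. d \<alpha> * mono_fun \<alpha> x)"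
    using assms by (auto simp: poly_fun_le_def)
  then have "f x + g x = (\<Sum>\<alpha> | (\<Sum>i\<in>UNIV. \<alpha> i) \<le> k. (c \<alpha> + d \<alpha>) * mono_fun \<alpha> x)" for x
    by (simp add: sum.distrib distrib_right)
  then show ?thesis by (auto simp: poly_fun_le_def)
qed

lemma poly_fun_le_scale:
  assumes "f \<in> poly_fun_le k"
  shows "(\<lambda>x. r * f x) \<in> poly_fun_le k"
proof -
  obtain c where "\<And>x. f x = (\<Sum>\<alpha> | (\<Sum>i\<in>UNIV. \<alpha> i) \<le> k. c \<alpha> * mono_fun \<alpha> x)"
    using assms by (auto simp: poly_fun_le_def)
  then have "r * f x = (\<Sum>\<alpha> | (\<Sum>i\<in>UNIV. \<alpha> i) \<le> k. (r * c \<alpha>) * mono_fun \<alpha> x)" for x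
    by (simp add: sum_distrib_left mult.assoc)
  then show ?thesis
    unfolding poly_fun_le_def by (intro CollectI exI[of _ "\<lambda>\<alpha>. r * c \<alpha>"]) simp
qed

lemma poly_fun_le_sum:
  assumes "\<And>i. i \<in> I \<Longrightarrow> f i \<in> poly_fun_le k"
  shows "(\<lambda>x. \<Sum>i\<in>I. f i x) \<in> poly_fun_le k"
  using assms
proof (induction I rule: infinite_finite_induct)
  case (insert i I)
  then show ?case using poly_fun_le_add[of "f i" k "\<lambda>x. \<Sum>i\<in>I. f i x"] by simp
qed (auto simp: poly_fun_le_def intro!: exI[of _ "\<lambda>_. 0"])

lemma poly_fun_le_mult:
  assumes "f \<in> poly_fun_le k" "g \<in> poly_fun_le l"
  shows "(\<lambda>x. f x * g x) \<in> poly_fun_le (k + l)"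
proof -
  obtain c d where f: "\<And>x. f x = (\<Sum>\<alpha> | (\<Sum>i\<in>UNIV. \<alpha> i) \<le> k. c \<alpha> * mono_fun \<alpha> x)"
    and g: "\<And>x. g x = (\<Sum>\<alpha> | (\<Sum>i\<in>UNIV. \<alpha> i) \<le> l. d \<alpha> * mono_fun \<alpha> x)"
    using assms by (auto simp: poly_fun_le_def)
  have "f x * g x = (\<Sum>\<alpha> | (\<Sum>i\<in>UNIV. \<alpha> i) \<le> k. \<Sum>\<beta> | (\<Sum>i\<in>UNIV. \<beta> i) \<le> l.
      c \<alpha> * (d \<beta> * mono_fun (\<lambda>i. \<alpha> i + \<beta> i) x))" for x
    unfolding f g sum_product
    by (intro sum.cong refl) (simp add: mono_fun_def power_add prod.distrib algebra_simps)
  moreover have "(\<lambda>x. \<Sum>\<alpha> | (\<Sum>i\<in>UNIV. \<alpha> i) \<le> k. \<Sum>\<beta> | (\<Sum>i\<in>UNIV. \<beta> i) \<le> l.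
      c \<alpha> * (d \<beta> * mono_fun (\<lambda>i. \<alpha> i + \<beta> i) x)) \<in> poly_fun_le (k + l)"
    by (intro poly_fun_le_sum poly_fun_le_scale mono_fun_in_poly_fun_le)
      (simp add: sum.distrib add_mono)
  ultimately show ?thesis by (simp only:)
qed

lemma poly_fun_le_const: "(\<lambda>x. r) \<in> poly_fun_le k"
  using poly_fun_le_scale[OF mono_fun_in_poly_fun_le[of "\<lambda>_. 0" k], of r]
  by (simp add: mono_fun_def)

text \<open>Multiplication by the constant 1, read as a polynomial of degree at most
  \<open>l - k\<close>, raises the bound.\<close>

lemma poly_fun_le_mono: "f \<in> poly_fun_le k \<Longrightarrow> k \<le> l \<Longrightarrow> f \<in> poly_fun_le l"
  using poly_fun_le_mult[OF _ poly_fun_le_const[of 1 "l - k"], of f k] by simp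

lemma poly_funs_add: "f \<in> poly_funs \<Longrightarrow> g \<in> poly_funs \<Longrightarrow> (\<lambda>x. f x + g x) \<in> poly_funs"
proof -
  assume "f \<in> poly_funs" "g \<in> poly_funs"
  then obtain k l where "f \<in> poly_fun_le k" "g \<in> poly_fun_le l" by (auto simp: poly_funs_def)
  then have "f \<in> poly_fun_le (max k l)" "g \<in> poly_fun_le (max k l)"
    by (auto elim!: poly_fun_le_mono)
  then show ?thesis unfolding poly_funs_def using poly_fun_le_add by blast
qed

lemma poly_funs_mult: "f \<in> poly_funs \<Longrightarrow> g \<in> poly_funs \<Longrightarrow> (\<lambda>x. f x * g x) \<in> poly_funs"
  unfolding poly_funs_def by (blast intro: poly_fun_le_mult)

lemma poly_funs_const: "(\<lambda>x. r) \<in> poly_funs"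
  unfolding poly_funs_def using poly_fun_le_const by blast

lemma poly_funs_diff: "f \<in> poly_funs \<Longrightarrow> g \<in> poly_funs \<Longrightarrow> (\<lambda>x. f x - g x) \<in> poly_funs"
  using poly_funs_add[OF _ poly_funs_mult[OF poly_funs_const[of "-1"]], of f g] by simp

lemma poly_funs_sum:
  assumes "\<And>i. i \<in> I \<Longrightarrow> f i \<in> poly_funs"
  shows "(\<lambda>x. \<Sum>i\<in>I. f i x) \<in> poly_funs"
  using assms
proof (induction I rule: infinite_finite_induct)
  case (insert i I)
  then show ?case using poly_funs_add[of "f i" "\<lambda>x. \<Sum>i\<in>I. f i x"] by simp
qed (auto simp: poly_funs_const)

lemma poly_funs_coord: "(\<lambda>x::'a::field ^ 'n::finite. x $ i) \<in> poly_funs"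
proof -
  have "(\<Prod>j\<in>UNIV. x $ j ^ (if j = i then 1 else 0)) = x $ i" for x :: "'a ^ 'n"
  proof -
    have "(\<Prod>j\<in>UNIV. x $ j ^ (if j = i then 1 else 0)) = (\<Prod>j\<in>UNIV. if j = i then x $ j else 1)"
      by (intro prod.cong) auto
    then show ?thesis by simp
  qed
  then have "mono_fun (\<lambda>j. if j = i then 1 else 0) = (\<lambda>x::'a ^ 'n. x $ i)"
    by (simp add: mono_fun_def fun_eq_iff)
  moreover have "mono_fun (\<lambda>j. if j = i then 1 else 0) \<in> (poly_fun_le 1 :: ('a ^ 'n \<Rightarrow> 'a) set)"
    by (intro mono_fun_in_poly_fun_le) simp
  ultimately show ?thesis by (auto simp: poly_funs_def)
qed

text \<open>A nonzero combination of least degree divides every member, since the remainder of a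
  division by it is again a combination.\<close>

lemma bezout_family:
  fixes \<eta> :: "'i \<Rightarrow> 'a::field poly"
  assumes "finite I" "k \<in> I" "\<eta> k \<noteq> 0"
  shows "\<exists>d w. d \<noteq> 0 \<and> d = (\<Sum>i\<in>I. w i * \<eta> i) \<and> (\<forall>i\<in>I. d dvd \<eta> i)"
proof -
  define Q where "Q n \<longleftrightarrow> (\<exists>w. (\<Sum>i\<in>I. w i * \<eta> i) \<noteq> 0 \<and> degree (\<Sum>i\<in>I. w i * \<eta> i) = n)" for n
  have single: "(\<Sum>i\<in>I. (if i = j then 1 else 0) * \<eta> i) = \<eta> j" if "j \<in> I" for j
    using assms(1) that by (simp add: if_distrib if_distribR cong: if_cong)
  have "Q (degree (\<eta> k))"
    unfolding Q_def using single[OF assms(2)] assms(3)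
    by (intro exI[of _ "\<lambda>i. if i = k then 1 else 0"]) simp
  then obtain n where "Q n" and min: "\<And>m. m < n \<Longrightarrow> \<not> Q m" using exists_least_iff[of Q] by blast
  then obtain w where w: "(\<Sum>i\<in>I. w i * \<eta> i) \<noteq> 0" "degree (\<Sum>i\<in>I. w i * \<eta> i) = n"
    by (auto simp: Q_def)
  define d where "d = (\<Sum>i\<in>I. w i * \<eta> i)"
  have "d dvd \<eta> j" if "j \<in> I" for j
  proof (rule ccontr)
    assume nd: "\<not> d dvd \<eta> j"
    define v where "v i = (if i = j then 1 else 0) - (\<eta> j div d) * w i" for i
    have "(\<Sum>i\<in>I. v i * \<eta> i) = \<eta> j - (\<eta> j div d) * d"
      unfolding v_def left_diff_distrib sum_subtractf single[OF that]
      by (simp add: d_def sum_distrib_left mult.assoc)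
    also have "\<dots> = \<eta> j mod d" by (simp add: minus_div_mult_eq_mod)
    finally have v: "(\<Sum>i\<in>I. v i * \<eta> i) = \<eta> j mod d" .
    have nz: "\<eta> j mod d \<noteq> 0" using nd by (simp add: dvd_eq_mod_eq_0)
    then have "degree (\<eta> j mod d) < n"
      using degree_mod_less[of d "\<eta> j"] w by (auto simp: d_def)
    moreover have "Q (degree (\<eta> j mod d))" unfolding Q_def using v nz by (intro exI[of _ v]) simp
    ultimately show False using min by blast
  qed
  then show ?thesis using w(1) by (intro exI[of _ d] exI[of _ w]) (auto simp: d_def)
qed

text \<open>Nakayama's lemma by elimination: \<open>\<Lambda>\<close> vanishes at \<open>P\<close>, so \<open>s - \<Lambda> (Suc m) (Suc m)\<close> does not,
  and multiplying by it allows the last generator to be eliminated.\<close>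

lemma nakayama_elimination:
  fixes x :: "'t \<Rightarrow> 'a::field ^ 'n::finite" and e :: "nat \<Rightarrow> 't \<Rightarrow> 'a"
  assumes "s \<in> poly_funs" "s P \<noteq> 0" "\<And>j l. \<Lambda> j l \<in> poly_funs" "\<And>j l. \<Lambda> j l P = 0"
    and "\<And>t j. t \<in> G \<Longrightarrow> j \<le> m \<Longrightarrow> s (x t) * e j t = (\<Sum>l\<le>m. \<Lambda> j l (x t) * e l t)"
  shows "\<exists>f\<in>poly_funs. f P \<noteq> 0 \<and> (\<forall>t\<in>G. f (x t) * e 0 t = 0)"
  using assms
proof (induction m arbitrary: s \<Lambda>)
  case 0
  show ?case
  proof (intro bexI conjI ballI)
    show "(\<lambda>y. s y - \<Lambda> 0 0 y) \<in> poly_funs" using 0 by (intro poly_funs_diff)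
    show "s P - \<Lambda> 0 0 P \<noteq> 0" using 0 by simp
    show "(s (x t) - \<Lambda> 0 0 (x t)) * e 0 t = 0" if "t \<in> G" for t
      using 0(5)[OF that, of 0] by (simp add: algebra_simps)
  qed
next
  case (Suc m)
  let ?M = "Suc m"
  define \<mu> where "\<mu> y = s y - \<Lambda> ?M ?M y" for y
  have \<mu>: "\<mu> \<in> poly_funs" unfolding \<mu>_def using Suc.prems by (intro poly_funs_diff)
  show ?case
  proof (rule Suc.IH[where s = "\<lambda>y. \<mu> y * s y" and
        \<Lambda> = "\<lambda>j l y. \<mu> y * \<Lambda> j l y + \<Lambda> j ?M y * \<Lambda> ?M l y"])
    show "(\<lambda>y. \<mu> y * s y) \<in> poly_funs" using \<mu> Suc.prems by (intro poly_funs_mult)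
    show "\<mu> P * s P \<noteq> 0" using Suc.prems by (simp add: \<mu>_def)
    show "(\<lambda>y. \<mu> y * \<Lambda> j l y + \<Lambda> j ?M y * \<Lambda> ?M l y) \<in> poly_funs" for j l
      using \<mu> Suc.prems by (intro poly_funs_add poly_funs_mult)
    show "\<mu> P * \<Lambda> j l P + \<Lambda> j ?M P * \<Lambda> ?M l P = 0" for j l using Suc.prems by simp
    fix t j assume t: "t \<in> G" and j: "j \<le> m"
    \<comment> \<open>The relation of the last generator, solved for \<open>\<mu>\<close> times that
      generator; it is substituted into the other relations.\<close>
    have 1: "\<mu> (x t) * e ?M t = (\<Sum>l\<le>m. \<Lambda> ?M l (x t) * e l t)"
      using Suc.prems(5)[OF t, of ?M] by (simp add: \<mu>_def algebra_simps)
    have "\<mu> (x t) * s (x t) * e j t = \<mu> (x t) * (\<Sum>l\<le>?M. \<Lambda> j l (x t) * e l t)"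
      using Suc.prems(5)[OF t, of j] j by (simp add: mult.assoc)
    also have "\<dots> = \<mu> (x t) * (\<Sum>l\<le>m. \<Lambda> j l (x t) * e l t) + \<Lambda> j ?M (x t) * (\<mu> (x t) * e ?M t)"
      by (simp add: algebra_simps)
    also have "\<dots> = (\<Sum>l\<le>m. (\<mu> (x t) * \<Lambda> j l (x t) + \<Lambda> j ?M (x t) * \<Lambda> ?M l (x t)) * e l t)"
      unfolding 1 by (simp add: sum_distrib_left sum.distrib algebra_simps)
    finally show "\<mu> (x t) * s (x t) * e j t
      = (\<Sum>l\<le>m. (\<mu> (x t) * \<Lambda> j l (x t) + \<Lambda> j ?M (x t) * \<Lambda> ?M l (x t)) * e l t)" .
  qed
qed

text \<open>In \<open>h = (\<Sum>i\<in>UNIV. h * w i * \<eta> i)\<close> all coefficients except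
  that of \<open>\<eta> i0\<close> are reduced modulo \<open>\<eta> i0\<close>, and the degree of
  \<open>h\<close> then controls the last one.\<close>

lemma bezout_degree_bound:
  fixes \<eta> :: "'n::finite \<Rightarrow> 'a::field poly"
  assumes one: "1 = (\<Sum>i\<in>UNIV. w i * \<eta> i)" and deg: "\<And>i. degree (\<eta> i) \<le> D"
    and i0: "degree (\<eta> i0) = D" and D: "0 < D" and h: "degree h < 2 * D"
  shows "\<exists>a. (\<forall>i. degree (a i) < D) \<and> h = (\<Sum>i\<in>UNIV. a i * \<eta> i)"
proof -
  let ?u = "\<eta> i0"
  have u0: "?u \<noteq> 0" using i0 D by auto
  define b where "b i = (h * w i) mod ?u" for i
  have db: "degree (b i) < D" for i
    using degree_mod_less'[of ?u "h * w i"] u0 i0 D by (cases "b i = 0") (auto simp: b_def)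
  \<comment> \<open>The part left for \<open>\<eta> i0\<close>. It is a multiple of
    \<open>\<eta> i0\<close> because \<open>b i\<close> is congruent to \<open>h * w i\<close>, and
    its degree is below \<open>2 * D\<close>, so the quotient has degree below
    \<open>D\<close>.\<close>
  define r where "r = h - (\<Sum>i\<in>UNIV-{i0}. b i * \<eta> i)"
  have "h = (\<Sum>i\<in>UNIV. (h * w i) * \<eta> i)"
    using arg_cong[OF one, of "\<lambda>p. h * p"] by (simp add: sum_distrib_left mult.assoc)
  then have "r = (\<Sum>i\<in>UNIV. (h * w i) * \<eta> i) - (\<Sum>i\<in>UNIV-{i0}. b i * \<eta> i)" by (simp add: r_def)
  also have "\<dots> = (h * w i0) * ?u + (\<Sum>i\<in>UNIV-{i0}. (h * w i - b i) * \<eta> i)"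
    by (subst sum.remove[of UNIV i0]) (auto simp: left_diff_distrib sum_subtractf)
  also have "?u dvd \<dots>"
  proof (intro dvd_add dvd_sum)
    show "?u dvd (h * w i - b i) * \<eta> i" for i
      unfolding b_def by (simp add: minus_mod_eq_mult_div)
  qed simp
  finally obtain a0 where a0: "r = ?u * a0" by (elim dvdE)
  have dr: "degree r < 2 * D"
    unfolding r_def
  proof (rule degree_diff_less[OF h])
    have "degree (b i * \<eta> i) \<le> 2 * D - 1" for i
      using degree_mult_le[of "b i" "\<eta> i"] db[of i] deg[of i] by linarith
    then have "degree (\<Sum>i\<in>UNIV-{i0}. b i * \<eta> i) \<le> 2 * D - 1"
      by (intro degree_sum_le) auto
    then show "degree (\<Sum>i\<in>UNIV-{i0}. b i * \<eta> i) < 2 * D" using D by linarith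
  qed
  have "degree a0 < D"
  proof (cases "a0 = 0")
    case False
    then have "degree r = D + degree a0" unfolding a0 using u0 i0 by (simp add: degree_mult_eq)
    then show ?thesis using dr by linarith
  qed (use D in simp)
  moreover have "h = (\<Sum>i\<in>UNIV. (b(i0 := a0)) i * \<eta> i)"
  proof -
    have "(\<Sum>i\<in>UNIV. (b(i0 := a0)) i * \<eta> i) = a0 * ?u + (\<Sum>i\<in>UNIV-{i0}. (b(i0 := a0)) i * \<eta> i)"
      by (subst sum.remove[of UNIV i0]) auto
    also have "(\<Sum>i\<in>UNIV-{i0}. (b(i0 := a0)) i * \<eta> i) = (\<Sum>i\<in>UNIV-{i0}. b i * \<eta> i)"
      by (intro sum.cong) auto
    finally show ?thesis using a0 by (simp add: r_def algebra_simps)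
  qed
  ultimately show ?thesis using db by (intro exI[of _ "b(i0 := a0)"]) auto
qed

lemma poly_eq_sum_coeff:
  fixes p :: "'a::comm_semiring_1 poly"
  assumes "degree p < D"
  shows "poly p x = (\<Sum>l\<le>D - 1. coeff p l * x ^ l)"
  unfolding poly_altdef
proof (rule sum.mono_neutral_left)
  show "{..degree p} \<subseteq> {..D - 1}" using assms by auto
qed (auto simp: coeff_eq_0)

text \<open>The integrality of the coordinate ring of the projective line over that of the curve: if the
  forms \<open>\<psi> i - P i * \<psi>0\<close> of degree \<open>D\<close> have no common zero, they generate all forms of degree
  \<open>2 * D - 1\<close>, so the powers of the parameter span a module that equals its multiple by the maximal
  ideal of \<open>P\<close>.\<close>

lemma separating_poly_fun:
  fixes \<psi>0 :: "real poly" and \<psi> :: "'n::finite \<Rightarrow> real poly" and P :: "real ^ 'n"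
  defines "\<eta> \<equiv> \<lambda>i. \<psi> i - smult (P $ i) \<psi>0"
  assumes one: "1 = (\<Sum>i\<in>UNIV. w i * \<eta> i)" and deg: "degree \<psi>0 \<le> D" "\<And>i. degree (\<psi> i) \<le> D"
    and i0: "degree (\<eta> i0) = D" and D: "0 < D"
  shows "\<exists>f\<in>poly_funs. f P \<noteq> 0 \<and> (\<forall>y\<in>rat_image \<psi>0 \<psi>. f y = 0)"
proof -
  have degc: "degree (\<eta> i) \<le> D" for i
    unfolding \<eta>_def using deg by (intro degree_diff_le order_trans[OF degree_smult_le])
  have "\<exists>a. (\<forall>i. degree (a i) < D) \<and> \<psi>0 * monom 1 j = (\<Sum>i\<in>UNIV. a i * \<eta> i)" if "j < D" for j
  proof (rule bezout_degree_bound[OF one degc i0 D])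
    have "degree (\<psi>0 * monom 1 j) \<le> D + j"
      using degree_mult_le[of \<psi>0 "monom 1 j"] deg(1) by (simp add: degree_monom_eq)
    then show "degree (\<psi>0 * monom 1 j) < 2 * D" using that by linarith
  qed
  then obtain a where a: "\<And>j i. j < D \<Longrightarrow> degree (a j i) < D"
    "\<And>j. j < D \<Longrightarrow> \<psi>0 * monom 1 j = (\<Sum>i\<in>UNIV. a j i * \<eta> i)" by metis
  \<comment> \<open>Coefficients obtained by dividing the identity for
    \<open>\<psi>0 * monom 1 j\<close> by \<open>\<psi>0\<close>; being linear in
    \<open>y - P\<close>, they vanish at \<open>P\<close>.\<close>
  define \<Lambda> where "\<Lambda> j l y = (\<Sum>i\<in>UNIV. coeff (a j i) l * (y $ i - P $ i))"
    for j l and y :: "real ^ 'n"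
  define G where "G = {t. poly \<psi>0 t \<noteq> 0}"
  \<comment> \<open>The generators are the powers \<open>t ^ j\<close> with \<open>j < D\<close>.
    The one of index 0 is 1, so what annihilates it vanishes on the image.\<close>
  have "\<exists>f\<in>poly_funs. f P \<noteq> 0 \<and> (\<forall>t\<in>G. f (rat_point \<psi>0 \<psi> t) * (\<lambda>j t. t ^ j) 0 t = 0)"
  proof (rule nakayama_elimination[where s = "\<lambda>_. 1" and m = "D - 1" and \<Lambda> = \<Lambda>])
    show "\<Lambda> j l \<in> poly_funs" for j l
      unfolding \<Lambda>_def
      by (intro poly_funs_sum poly_funs_mult poly_funs_diff poly_funs_const poly_funs_coord)
    show "\<Lambda> j l P = 0" for j l by (simp add: \<Lambda>_def)
    fix t j assume t: "t \<in> G" and "j \<le> D - 1"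
    then have j: "j < D" using D by linarith
    let ?y = "rat_point \<psi>0 \<psi> t"
    have t0: "poly \<psi>0 t \<noteq> 0" using t by (simp add: G_def)
    have \<eta>t: "poly (\<eta> i) t = poly \<psi>0 t * (?y $ i - P $ i)" for i
      using t0 by (simp add: \<eta>_def rat_point_def algebra_simps)
    have "poly \<psi>0 t * t ^ j = (\<Sum>i\<in>UNIV. poly (a j i) t * poly (\<eta> i) t)"
      using arg_cong[OF a(2)[OF j], of "\<lambda>p. poly p t"] by (simp add: poly_sum poly_monom)
    also have "\<dots> = poly \<psi>0 t * (\<Sum>i\<in>UNIV. poly (a j i) t * (?y $ i - P $ i))"
      unfolding \<eta>t by (simp add: sum_distrib_left algebra_simps)
    finally have "t ^ j = (\<Sum>i\<in>UNIV. poly (a j i) t * (?y $ i - P $ i))" using t0 by simp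
    also have "\<dots> = (\<Sum>i\<in>UNIV. \<Sum>l\<le>D - 1. coeff (a j i) l * (?y $ i - P $ i) * t ^ l)"
      by (intro sum.cong refl)
        (simp add: poly_eq_sum_coeff[OF a(1)[OF j]] sum_distrib_left sum_distrib_right algebra_simps)
    also have "\<dots> = (\<Sum>l\<le>D - 1. \<Lambda> j l ?y * t ^ l)"
      unfolding \<Lambda>_def sum_distrib_right by (rule sum.swap)
    finally show "1 * t ^ j = (\<Sum>l\<le>D - 1. \<Lambda> j l ?y * t ^ l)" by simp
  qed (auto simp: poly_funs_const)
  then show ?thesis by (auto simp: rat_image_def G_def)
qed

section \<open>Complex parameters of the points of the closure\<close>

definition param :: "real poly \<Rightarrow> ('n::finite \<Rightarrow> real poly) \<Rightarrow> complex \<Rightarrow> real ^ 'n \<Rightarrow> bool" where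
  "param \<psi>0 \<psi> z P \<longleftrightarrow> poly (cpoly \<psi>0) z \<noteq> 0 \<and>
     (\<forall>i. poly (cpoly (\<psi> i)) z = of_real (P $ i) * poly (cpoly \<psi>0) z)"

lemma max_degree_ge: "degree \<psi>0 \<le> max_degree \<psi>0 \<psi>" "degree (\<psi> i) \<le> max_degree \<psi>0 \<psi>"
  unfolding max_degree_def by (intro Max_ge; simp)+

lemma cpoly_1 [simp]: "cpoly 1 = 1"
  by (simp add: map_poly_1')

text \<open>A point \<open>P\<close> with neither a complex parameter nor the role of the value at
  infinity leaves the \<open>\<psi> i - smult (P $ i) \<psi>0\<close> without common zero on the
  complex projective line. Then some polynomial function vanishes on the image but not at
  \<open>P\<close>.\<close>

lemma zariski_closure_param:
  fixes \<psi> :: "'n::finite \<Rightarrow> real poly"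
  assumes cop: "1 = w0 * \<psi>0 + (\<Sum>i\<in>UNIV. w i * \<psi> i)"
    and inf: "infinite (rat_image \<psi>0 \<psi>)" and P: "P \<in> zariski_closure (rat_image \<psi>0 \<psi>)"
  shows "(\<exists>z. param \<psi>0 \<psi> z P) \<or>
    (degree \<psi>0 = max_degree \<psi>0 \<psi> \<and>
     (\<forall>i. coeff (\<psi> i) (max_degree \<psi>0 \<psi>) = P $ i * coeff \<psi>0 (max_degree \<psi>0 \<psi>)))"
proof (rule ccontr)
  assume neg: "\<not> ?thesis"
  define D where "D = max_degree \<psi>0 \<psi>"
  note deg = max_degree_ge(1)[of \<psi>0 \<psi>, folded D_def] max_degree_ge(2)[of \<psi> _ \<psi>0, folded D_def]
  define \<eta> where "\<eta> i = \<psi> i - smult (P $ i) \<psi>0" for i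
  have \<psi>: "\<psi> i = \<eta> i + smult (P $ i) \<psi>0" for i by (simp add: \<eta>_def)
  have ev: "poly (cpoly (\<psi> i)) z = poly (cpoly (\<eta> i)) z + of_real (P $ i) * poly (cpoly \<psi>0) z" for i z
    by (subst \<psi>) (simp add: cpoly_add cpoly_smult)
  \<comment> \<open>A common zero is a parameter of \<open>P\<close> if \<open>\<psi>0\<close> is
    nonzero there; otherwise all \<open>\<psi> i\<close> vanish as well, against
    \<open>cop\<close>.\<close>
  have no_root: "\<exists>i. poly (cpoly (\<eta> i)) z \<noteq> 0" for z
  proof (rule ccontr)
    assume "\<nexists>i. poly (cpoly (\<eta> i)) z \<noteq> 0"
    then have *: "poly (cpoly (\<psi> i)) z = of_real (P $ i) * poly (cpoly \<psi>0) z" for i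
      using ev[of i z] by simp
    then have "poly (cpoly \<psi>0) z = 0" using neg by (auto simp: param_def)
    moreover have "poly (cpoly 1) z = poly (cpoly w0) z * poly (cpoly \<psi>0) z
        + (\<Sum>i\<in>UNIV. poly (cpoly (w i)) z * poly (cpoly (\<psi> i)) z)"
      by (subst cop) (simp add: cpoly_add cpoly_mult cpoly_sum poly_sum)
    ultimately show False using * by simp
  qed
  obtain k where "poly (cpoly (\<eta> k)) 0 \<noteq> 0" using no_root[of 0] by blast
  then have "\<eta> k \<noteq> 0" by auto
  then obtain d v where d: "d \<noteq> 0" "d = (\<Sum>i\<in>UNIV. v i * \<eta> i)" "\<And>i. d dvd \<eta> i"
    using bezout_family[of UNIV k \<eta>] by auto
  have "degree d = 0"
  proof (rule ccontr)
    assume "degree d \<noteq> 0"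
    then have "\<not> constant (poly (cpoly d))" by (simp add: constant_degree)
    then obtain z where z: "poly (cpoly d) z = 0" using fundamental_theorem_of_algebra by blast
    have "poly (cpoly (\<eta> i)) z = 0" for i
      using d(3)[of i] z by (auto simp: cpoly_mult elim!: dvdE)
    then show False using no_root[of z] by blast
  qed
  then obtain r where r: "d = [:r:]" by (auto elim: degree_eq_zeroE)
  with d(1) have r0: "r \<noteq> 0" by auto
  have one: "1 = (\<Sum>i\<in>UNIV. smult (1 / r) (v i) * \<eta> i)"
  proof -
    have sm: "smult (1 / r) f = [:1 / r:] * f" for f by simp
    have "(\<Sum>i\<in>UNIV. smult (1 / r) (v i) * \<eta> i) = smult (1 / r) d"
      unfolding d(2) sm by (simp only: sum_distrib_left mult.assoc)
    then show ?thesis using r r0 by (simp add: one_pCons)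
  qed
  have D0: "0 < D"
  proof (rule ccontr)
    assume "\<not> 0 < D"
    then have "degree \<psi>0 = 0" "\<And>i. degree (\<psi> i) = 0" using deg by auto
    then have "rat_point \<psi>0 \<psi> t = rat_point \<psi>0 \<psi> 0" for t
      by (auto simp: rat_point_def poly_altdef vec_eq_iff)
    then have "rat_image \<psi>0 \<psi> \<subseteq> {rat_point \<psi>0 \<psi> 0}" by (auto simp: rat_image_def)
    then show False using inf finite_subset by blast
  qed
  have degc: "degree (\<eta> i) \<le> D" for i
    unfolding \<eta>_def using deg by (intro degree_diff_le order_trans[OF degree_smult_le])
  \<comment> \<open>Infinity is no common zero. Otherwise either \<open>\<psi>0\<close> has degree
    \<open>D\<close> and \<open>P\<close> is the value at infinity, or no polynomial of the
    parametrization reaches degree \<open>D\<close>.\<close>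
  have "\<exists>i0. degree (\<eta> i0) = D"
  proof (rule ccontr)
    assume none: "\<nexists>i0. degree (\<eta> i0) = D"
    have "degree (\<eta> i) < D" for i using none degc[of i] by (meson le_neq_implies_less)
    then have c: "coeff (\<psi> i) D = P $ i * coeff \<psi>0 D" for i
      using coeff_eq_0[of "\<eta> i" D] by (simp add: \<eta>_def)
    then have "degree \<psi>0 \<noteq> D" using neg by (auto simp: D_def)
    then have "degree \<psi>0 < D" using deg(1) by simp
    then have "coeff \<psi>0 D = 0" by (rule coeff_eq_0)
    then have "coeff (\<psi> i) D = 0" for i using c by simp
    then have "degree (\<psi> i) \<noteq> D" for i using D0 by (metis degree_0 leading_coeff_0_iff not_less0)
    moreover have "D \<in> insert (degree \<psi>0) (range (\<lambda>i. degree (\<psi> i)))"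
      unfolding D_def max_degree_def by (intro Max_in) auto
    ultimately show False using \<open>degree \<psi>0 \<noteq> D\<close> by auto
  qed
  then obtain i0 where i0: "degree (\<eta> i0) = D" by blast
  obtain f where "f \<in> poly_funs" "f P \<noteq> 0" "\<forall>y\<in>rat_image \<psi>0 \<psi>. f y = 0"
    using separating_poly_fun[OF one[unfolded \<eta>_def] deg i0[unfolded \<eta>_def] D0] by blast
  then show False using P by (auto simp: zariski_closure_def)
qed

section \<open>Change of parameter\<close>

text \<open>Since \<open>(1 + t0 * u) ^ j * u ^ (D - j) = u ^ D * (t0 + 1 / u) ^ j\<close>, this is the numerator of
  \<open>h\<close> in the parameter \<open>u = 1 / (t - t0)\<close>.\<close>

definition moebius :: "nat \<Rightarrow> real \<Rightarrow> real poly \<Rightarrow> real poly" where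
  "moebius D t0 h = (\<Sum>j\<le>D. smult (coeff h j) ([:1, t0:] ^ j * [:0, 1:] ^ (D - j)))"

lemma degree_moebius: "degree (moebius D t0 h) \<le> D"
  unfolding moebius_def
proof (intro degree_sum_le order_trans[OF degree_smult_le] order_trans[OF degree_mult_le])
  fix j assume "j \<in> {..D}"
  moreover have "degree ([:1, t0:] ^ j) \<le> j"
    using degree_power_le[of "[:1, t0:]" j] degree_pCons_le[of 1 "[:t0:]"]
    by (simp split: if_splits)
  moreover have "degree ([:0, 1::real:] ^ (D - j)) \<le> D - j"
    using degree_power_le[of "[:0, 1::real:]" "D - j"] by simp
  ultimately show "degree ([:1, t0:] ^ j) + degree ([:0, 1::real:] ^ (D - j)) \<le> D" by simp
qed simp

lemma poly_moebius:
  assumes "degree h \<le> D" "u \<noteq> 0"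
  shows "poly (cpoly (moebius D t0 h)) u = u ^ D * poly (cpoly h) (of_real t0 + 1 / u)"
proof -
  have "poly (cpoly (moebius D t0 h)) u = (\<Sum>j\<le>D. of_real (coeff h j) * ((1 + u * of_real t0) ^ j * u ^ (D - j)))"
    by (simp add: moebius_def cpoly_sum cpoly_smult cpoly_mult cpoly_power poly_sum map_poly_pCons)
  also have "\<dots> = (\<Sum>j\<le>D. u ^ D * (of_real (coeff h j) * (of_real t0 + 1 / u) ^ j))"
  proof (intro sum.cong refl)
    fix j assume "j \<in> {..D}"
    then have "u ^ D = u ^ j * u ^ (D - j)" by (simp flip: power_add)
    moreover have "1 + u * of_real t0 = u * (of_real t0 + 1 / u)" using assms(2) by (simp add: field_simps)
    ultimately show "of_real (coeff h j) * ((1 + u * of_real t0) ^ j * u ^ (D - j))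
      = u ^ D * (of_real (coeff h j) * (of_real t0 + 1 / u) ^ j)"
      by (simp only: power_mult_distrib) (simp add: algebra_simps)
  qed
  also have "\<dots> = u ^ D * poly (cpoly h) (of_real t0 + 1 / u)"
    using poly_eq_sum_coeff[of "cpoly h" "Suc D" "of_real t0 + 1 / u"] assms(1)
    by (simp add: coeff_map_poly sum_distrib_left)
  finally show ?thesis .
qed

text \<open>The new parameter 0 stands for the old parameter infinity, where only coefficients of
  degree \<open>D\<close> matter.\<close>

lemma poly_moebius_0: "poly (cpoly (moebius D t0 h)) 0 = of_real (coeff h D)"
proof -
  have "poly (cpoly (moebius D t0 h)) 0 = (\<Sum>j\<le>D. of_real (coeff h j) * (0::complex) ^ (D - j))"
    by (simp add: moebius_def cpoly_sum cpoly_smult cpoly_mult cpoly_power poly_sum map_poly_pCons)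
  also have "\<dots> = (\<Sum>j\<le>D. if j = D then of_real (coeff h j) else 0)"
    by (intro sum.cong) (auto simp: power_0_left)
  finally show ?thesis by simp
qed

lemma param_moebius:
  assumes "param \<psi>0 \<psi> z P" "degree \<psi>0 \<le> D" "\<And>i. degree (\<psi> i) \<le> D" "z \<noteq> of_real t0"
  shows "param (moebius D t0 \<psi>0) (\<lambda>i. moebius D t0 (\<psi> i)) (1 / (z - of_real t0)) P"
  using assms by (simp add: param_def poly_moebius)

lemma param_moebius_infinity:
  assumes "coeff \<psi>0 D \<noteq> 0" "\<And>i. coeff (\<psi> i) D = P $ i * coeff \<psi>0 D"
  shows "param (moebius D t0 \<psi>0) (\<lambda>i. moebius D t0 (\<psi> i)) 0 P"
  using assms by (simp add: param_def poly_moebius_0)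

text \<open>The map \<open>u \<mapsto> t0 + 1 / u\<close> sends new roots injectively to old ones,
  since 0 is no root when the coefficient of degree \<open>D\<close> is nonzero. So the change of
  parameter creates no additional poles.\<close>

lemma card_roots_moebius:
  assumes "coeff h D \<noteq> 0" "degree h \<le> D"
  shows "moebius D t0 h \<noteq> 0" "card {u. poly (moebius D t0 h) u = 0} \<le> card {t. poly h t = 0}"
proof -
  show "moebius D t0 h \<noteq> 0" using poly_moebius_0[of D t0 h] assms(1) by auto
  have h0: "h \<noteq> 0" using assms(1) by auto
  have "t0 + 1 / u \<in> {t. poly h t = 0}" "u \<noteq> 0" if "poly (moebius D t0 h) u = 0" for u
  proof -
    have z: "poly (cpoly (moebius D t0 h)) (of_real u) = 0" using that by simp
    show u0: "u \<noteq> 0" using z poly_moebius_0[of D t0 h] assms(1) by (metis of_real_0 of_real_eq_0_iff)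
    then have "poly (cpoly h) (of_real (t0 + 1 / u)) = 0"
      using z poly_moebius[OF assms(2), of "of_real u" t0] by simp
    then show "t0 + 1 / u \<in> {t. poly h t = 0}" by (simp only: poly_cpoly_of_real) simp
  qed
  then show "card {u. poly (moebius D t0 h) u = 0} \<le> card {t. poly h t = 0}"
    by (intro card_inj_on_le[of "\<lambda>u. t0 + 1 / u"] poly_roots_finite[OF h0]) (auto simp: inj_on_def)
qed

text \<open>Pulled back to the parameter, the monomials of degree at most \<open>k\<close> form a
  rational family with denominator \<open>\<psi>0 ^ k\<close> and numerators of degree at most
  \<open>D * k\<close>.\<close>

lemma finite_rule_reduction:
  fixes \<psi>0 :: "real poly" and \<psi> :: "'n::finite \<Rightarrow> real poly" and w :: "real ^ 'n \<Rightarrow> real"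
  assumes \<psi>0: "\<psi>0 \<noteq> 0" and deg: "degree \<psi>0 \<le> D" "\<And>i. degree (\<psi> i) \<le> D" and k: "0 < k"
    and F: "conic_rep mono_fun {\<alpha>. (\<Sum>i\<in>UNIV. \<alpha> i) \<le> k} UNIV y F w"
    and par: "\<And>P. P \<in> F \<Longrightarrow> \<exists>z. param \<psi>0 \<psi> z P"
  shows "\<exists>X v. conic_rep mono_fun {\<alpha>. (\<Sum>i\<in>UNIV. \<alpha> i) \<le> k} UNIV y X v \<and>
    card X \<le> (D * k) div 2 + card {t. poly \<psi>0 t = 0} + 1"
proof -
  let ?A = "{\<alpha>::'n \<Rightarrow> nat. (\<Sum>i\<in>UNIV. \<alpha> i) \<le> k}"
  \<comment> \<open>Conjugate parameters belong to the same real point, so the closed upper half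
    plane suffices.\<close>
  have "\<exists>z. 0 \<le> Im z \<and> param \<psi>0 \<psi> z P" if P: "P \<in> F" for P
  proof -
    obtain z where z: "param \<psi>0 \<psi> z P" using par[OF P] by blast
    then have z': "param \<psi>0 \<psi> (cnj z) P" by (simp add: param_def poly_cpoly_cnj)
    show ?thesis
    proof (cases "0 \<le> Im z")
      case True
      then show ?thesis using z by blast
    next
      case False
      then show ?thesis using z' by (intro exI[of _ "cnj z"]) simp
    qed
  qed
  then obtain \<tau> where \<tau>: "\<And>P. P \<in> F \<Longrightarrow> 0 \<le> Im (\<tau> P) \<and> param \<psi>0 \<psi> (\<tau> P) P" by metis
  have finF: "finite F" using F by (simp add: conic_rep_def)
  \<comment> \<open>The factor \<open>\<psi>0 ^ (k - (\<Sum>i\<in>UNIV. \<alpha> i))\<close> brings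
    all pullbacks to the common denominator.\<close>
  define num where "num \<alpha> = (\<Prod>i\<in>UNIV. \<psi> i ^ \<alpha> i) * \<psi>0 ^ (k - (\<Sum>i\<in>UNIV. \<alpha> i))" for \<alpha> :: "'n \<Rightarrow> nat"
  define J where "J = \<tau> ` F \<inter> {z. 0 < Im z}"
  have quot: "poly (cpoly (num \<alpha>)) z / poly (cpoly (\<psi>0 ^ k)) z = of_real (mono_fun \<alpha> P)"
    if "param \<psi>0 \<psi> z P" "\<alpha> \<in> ?A" for \<alpha> z P
  proof -
    have "poly (cpoly (num \<alpha>)) z
      = (\<Prod>i\<in>UNIV. (of_real (P $ i) * poly (cpoly \<psi>0) z) ^ \<alpha> i) * poly (cpoly \<psi>0) z ^ (k - (\<Sum>i\<in>UNIV. \<alpha> i))"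
      using that(1) by (simp add: num_def param_def cpoly_mult cpoly_prod cpoly_power poly_prod)
    also have "\<dots> = of_real (mono_fun \<alpha> P) * (poly (cpoly \<psi>0) z ^ (\<Sum>i\<in>UNIV. \<alpha> i)
        * poly (cpoly \<psi>0) z ^ (k - (\<Sum>i\<in>UNIV. \<alpha> i)))"
      by (simp add: mono_fun_def power_mult_distrib prod.distrib power_sum)
    also have "\<dots> = of_real (mono_fun \<alpha> P) * poly (cpoly (\<psi>0 ^ k)) z"
      using that(2) by (simp add: cpoly_power flip: power_add)
    finally show ?thesis using that(1) by (simp add: param_def cpoly_power)
  qed
  have dn: "degree (num \<alpha>) \<le> D * k" if "\<alpha> \<in> ?A" for \<alpha>
  proof -
    have "degree (\<Prod>i\<in>UNIV. \<psi> i ^ \<alpha> i) \<le> (\<Sum>i\<in>UNIV. D * \<alpha> i)"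
    proof (rule order_trans[OF degree_prod_sum_le])
      show "(\<Sum>i\<in>UNIV. (degree \<circ> (\<lambda>i. \<psi> i ^ \<alpha> i)) i) \<le> (\<Sum>i\<in>UNIV. D * \<alpha> i)"
        using deg(2) by (intro sum_mono) (auto intro!: order_trans[OF degree_power_le] mult_mono)
    qed simp
    moreover have "degree (\<psi>0 ^ (k - (\<Sum>i\<in>UNIV. \<alpha> i))) \<le> D * (k - (\<Sum>i\<in>UNIV. \<alpha> i))"
      using deg(1) by (auto intro!: order_trans[OF degree_power_le] mult_mono)
    ultimately have "degree (num \<alpha>) \<le> D * (\<Sum>i\<in>UNIV. \<alpha> i) + D * (k - (\<Sum>i\<in>UNIV. \<alpha> i))"
      unfolding num_def by (intro order_trans[OF degree_mult_le] add_mono) (simp_all add: sum_distrib_left)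
    also have "\<dots> = D * k" using that by (simp flip: distrib_left)
    finally show ?thesis .
  qed
  have Jpar: "\<exists>P. param \<psi>0 \<psi> z P" if "z \<in> J" for z using that \<tau> by (auto simp: J_def)
  interpret rational_family ?A num "\<psi>0 ^ k" "D * k" J "\<lambda>_. 0"
  proof
    show "finite ?A" by (rule finite_multi_indices)
    show "poly (cpoly (\<psi>0 ^ k)) z \<noteq> 0" if "z \<in> J" for z
      using Jpar[OF that] by (auto simp: param_def cpoly_power)
    show "poly (cpoly (num \<alpha>)) z / poly (cpoly (\<psi>0 ^ k)) z \<in> \<real>" if "z \<in> J" "\<alpha> \<in> ?A" for z \<alpha>
      using Jpar[OF that(1)] quot[OF _ that(2)] by (metis Reals_of_real)
  qed (use \<psi>0 dn finF in \<open>auto simp: J_def num_def\<close>)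
  have Zeq: "Z = {t. poly \<psi>0 t = 0}" using k by (simp add: Z_def)
  define pt where "pt z = (\<chi> i. Re (poly (cpoly (\<psi> i)) z / poly (cpoly \<psi>0) z))" for z
  have pt: "pt z = P" if "param \<psi>0 \<psi> z P" for z P
    using that by (simp add: pt_def param_def vec_eq_iff)
  have parT: "param \<psi>0 \<psi> z (pt z)" if zT: "z \<in> T" for z
  proof (cases "z \<in> J")
    case True
    then show ?thesis using Jpar pt by force
  next
    case False
    then obtain t where t: "z = of_real t" "t \<notin> Z" using zT by (auto simp: T_def)
    then show ?thesis by (simp add: param_def pt_def Zeq flip: of_real_divide of_real_mult)
  qed
  have val: "val \<alpha> z = mono_fun \<alpha> P" if "param \<psi>0 \<psi> z P" "\<alpha> \<in> ?A" for \<alpha> z P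
    using quot[OF that] by (simp add: val_def)
  have \<tau>T: "\<tau> P \<in> T" if "P \<in> F" for P
  proof (cases "0 < Im (\<tau> P)")
    case True
    then have "\<tau> P \<in> J" using that by (simp add: J_def)
    then show ?thesis unfolding T_def by blast
  next
    case False
    then have "Im (\<tau> P) = 0" using \<tau>[OF that] by simp
    then have "\<exists>r. \<tau> P = of_real r" by (intro exI[of _ "Re (\<tau> P)"]) (simp add: complex_eq_iff)
    then obtain r where r: "\<tau> P = of_real r" by blast
    have "poly (cpoly \<psi>0) (\<tau> P) \<noteq> 0" using \<tau>[OF that] by (simp add: param_def)
    then have "r \<in> - Z" unfolding r by (simp add: Zeq)
    then show ?thesis unfolding T_def r by blast
  qed
  have "\<exists>v. conic_rep val ?A T y (\<tau> ` {P\<in>F. 0 < w P}) v"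
  proof (rule conic_rep_family[OF finF])
    show "0 \<le> w P" if "P \<in> F" for P using F that by (auto simp: conic_rep_def less_imp_le)
    show "y \<alpha> = (\<Sum>P\<in>F. w P * val \<alpha> (\<tau> P))" if "\<alpha> \<in> ?A" for \<alpha>
    proof -
      have "val \<alpha> (\<tau> P) = mono_fun \<alpha> P" if "P \<in> F" for P
        using val \<tau>[OF that] \<open>\<alpha> \<in> ?A\<close> by blast
      then show ?thesis using F that by (simp add: conic_rep_def)
    qed
  qed (rule \<tau>T)
  then obtain X v where X: "conic_rep val ?A T y X v" "card X \<le> (D * k) div 2 + card Z + 1"
    using few_nodes by blast
  have Xf: "finite X" "X \<subseteq> T" "\<And>z. z \<in> X \<Longrightarrow> 0 < v z"
    "\<And>\<alpha>. \<alpha> \<in> ?A \<Longrightarrow> y \<alpha> = (\<Sum>z\<in>X. v z * val \<alpha> z)"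
    using X(1) by (auto simp: conic_rep_def)
  \<comment> \<open>Different parameters may give the same point; merging them adds weights and only
    lowers the count.\<close>
  have "\<exists>v'. conic_rep mono_fun ?A UNIV y (pt ` {z\<in>X. 0 < v z}) v'"
  proof (rule conic_rep_family[OF Xf(1)])
    show "0 \<le> v z" if "z \<in> X" for z using Xf(3)[OF that] by simp
    show "y \<alpha> = (\<Sum>z\<in>X. v z * mono_fun \<alpha> (pt z))" if "\<alpha> \<in> ?A" for \<alpha>
      unfolding Xf(4)[OF that] using Xf(2) val[OF parT that] by (intro sum.cong) auto
  qed simp
  moreover have "card (pt ` {z\<in>X. 0 < v z}) \<le> card X"
    by (rule order_trans[OF card_image_le card_mono]) (use Xf(1) in auto)
  then have "card (pt ` {z\<in>X. 0 < v z}) \<le> (D * k) div 2 + card {t. poly \<psi>0 t = 0} + 1"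
    using X(2) unfolding Zeq by (rule order_trans)
  ultimately show ?thesis by blast
qed

text \<open>The complement of the support is a union of open null sets, and by Lindelof's theorem
  countably many of them cover it.\<close>

lemma AE_measure_support:
  fixes M :: "'a::second_countable_topology measure"
  assumes "sets M = sets borel"
  shows "AE x in M. x \<in> measure_support M"
proof -
  let ?\<F> = "{U. open U \<and> emeasure M U = 0}"
  obtain \<F> where \<F>: "\<F> \<subseteq> ?\<F>" "countable \<F>" "\<Union>\<F> = \<Union>?\<F>"
    using Lindelof[of ?\<F>] by auto
  have "U \<in> null_sets M" if "U \<in> \<F>" for U
    using \<F>(1) that assms by (auto simp: null_sets_def)
  then have "(\<Union>U\<in>\<F>. U) \<in> null_sets M" using \<F>(2) by (intro null_sets_UN') auto
  then have "AE x in M. x \<notin> \<Union>\<F>" by (auto dest: AE_not_in)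
  then show ?thesis
  proof eventually_elim
    fix x assume x: "x \<notin> \<Union>\<F>"
    have "x \<in> K" if "closed K" "emeasure M (- K) = 0" for K
      using x \<F>(3) that by (auto simp: open_Compl)
    then show "x \<in> measure_support M" by (auto simp: measure_support_def)
  qed
qed

section \<open>From the measure on the curve to the quadrature rule\<close>

theorem theorem4p9:
  fixes C :: "(real ^ 'n::finite) set"
    and \<phi>0 :: "real poly" and \<phi> :: "'n \<Rightarrow> real poly"
    and d D p s :: nat
    and M :: "(real ^ 'n) measure"
  assumes "rational_curve_param C \<phi>0 \<phi>"
    and "curve_has_degree C d"
    and "degree \<phi>0 \<le> d" and "\<And>i. degree (\<phi> i) \<le> d"
    and "D = max_degree \<phi>0 \<phi>"
    and "p = card {t. poly \<phi>0 t = 0}"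
    and "s \<ge> 1"
    and "sets M = sets borel"
    and "measure_support M \<subseteq> C"
    and "finite_moments M (2 * s - 1)"
  shows "\<exists>X w. quadrature_rule M (2 * s - 1) X w \<and>
           int (card X) \<le> int D * int s - \<lceil>real D / 2\<rceil> + int p + 1"
proof -
  define k where "k = 2 * s - 1"
  let ?A = "{\<alpha>::'n \<Rightarrow> nat. (\<Sum>i\<in>UNIV. \<alpha> i) \<le> k}"
  let ?y = "\<lambda>\<alpha>. LINT x|M. mono_fun \<alpha> x"
  have \<phi>0: "\<phi>0 \<noteq> 0" and inf: "infinite (rat_image \<phi>0 \<phi>)" and C: "C = zariski_closure (rat_image \<phi>0 \<phi>)"
    using assms(1) by (auto simp: rational_curve_param_def)
  have int: "integrable M (mono_fun \<alpha>)" if "\<alpha> \<in> ?A" for \<alpha>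
    using assms(10) that by (simp add: finite_moments_def k_def)
  have "AE x in M. x \<in> C" using AE_measure_support[OF assms(8)] assms(9) by (auto elim: eventually_mono)
  then obtain F w where F: "conic_rep mono_fun ?A C ?y F w"
    using tchakaloff[of ?A M mono_fun C] finite_multi_indices int by blast
  have finF: "finite F" and FC: "F \<subseteq> C" using F by (auto simp: conic_rep_def)
  have F': "conic_rep mono_fun ?A UNIV ?y F w" by (rule conic_rep_mono[OF F]) simp

  \<comment> \<open>Denominator and numerators form one family, whose greatest common divisor is
    cancelled; this increases neither the degrees nor the number of real poles.\<close>
  define \<phi>' where "\<phi>' = case_option \<phi>0 \<phi>"
  have UNIV_opt: "(\<Sum>i\<in>UNIV. f i) = f None + (\<Sum>i\<in>UNIV. f (Some i))" for f :: "'n option \<Rightarrow> real poly"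
    by (simp add: UNIV_option_conv sum.reindex)
  obtain g v where g: "g \<noteq> 0" "g = (\<Sum>i\<in>UNIV. v i * \<phi>' i)" "\<And>i. g dvd \<phi>' i"
    using bezout_family[of UNIV None \<phi>'] \<phi>0 by (auto simp: \<phi>'_def)
  obtain \<psi>' where \<psi>': "\<And>i. \<phi>' i = g * \<psi>' i" using g(3) unfolding dvd_def by metis
  define \<psi>0 where "\<psi>0 = \<psi>' None"
  define \<psi> where "\<psi> i = \<psi>' (Some i)" for i
  have \<phi>\<psi>: "\<phi>0 = g * \<psi>0" "\<phi> i = g * \<psi> i" for i
    using \<psi>'[of None] \<psi>'[of "Some i"] by (simp_all add: \<phi>'_def \<psi>0_def \<psi>_def)
  have "g * 1 = g * (\<Sum>i\<in>UNIV. v i * \<psi>' i)"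
    using g(2) unfolding \<psi>' by (simp add: sum_distrib_left algebra_simps)
  then have "1 = (\<Sum>i\<in>UNIV. v i * \<psi>' i)" by (rule mult_left_cancel[OF g(1), THEN iffD1])
  then have cop: "1 = v None * \<psi>0 + (\<Sum>i\<in>UNIV. v (Some i) * \<psi> i)"
    unfolding UNIV_opt \<psi>0_def \<psi>_def .
  have \<psi>0: "\<psi>0 \<noteq> 0" using \<phi>0 \<phi>\<psi> by auto
  \<comment> \<open>Cancelling may add points with parameters at zeros of \<open>g\<close>, so the
    image and its closure can only grow and still contain \<open>F\<close>.\<close>
  have sub: "rat_image \<phi>0 \<phi> \<subseteq> rat_image \<psi>0 \<psi>"
    unfolding rat_image_def rat_point_def \<phi>\<psi> by auto
  then have inf': "infinite (rat_image \<psi>0 \<psi>)" using inf finite_subset by blast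
  have FC': "P \<in> zariski_closure (rat_image \<psi>0 \<psi>)" if "P \<in> F" for P
    using that FC sub unfolding C zariski_closure_def by blast

  define D' where "D' = max_degree \<psi>0 \<psi>"
  note deg = max_degree_ge(1)[of \<psi>0 \<psi>, folded D'_def] max_degree_ge(2)[of \<psi> _ \<psi>0, folded D'_def]
  have "D' \<in> insert (degree \<psi>0) (range (\<lambda>i. degree (\<psi> i)))"
    unfolding D'_def max_degree_def by (intro Max_in) auto
  moreover have "degree \<psi>0 \<le> D"
    using max_degree_ge(1)[of \<phi>0 \<phi>] g(1) \<psi>0 unfolding assms(5) by (simp add: \<phi>\<psi> degree_mult_eq)
  moreover have "degree (\<psi> i) \<le> D" for i
    using max_degree_ge(2)[of \<phi> i \<phi>0] g(1) unfolding assms(5)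
    by (cases "\<psi> i = 0") (simp_all add: \<phi>\<psi> degree_mult_eq)
  ultimately have D'D: "D' \<le> D" by auto
  have p': "card {t. poly \<psi>0 t = 0} \<le> p"
    unfolding assms(6) using poly_roots_finite[OF \<phi>0] by (intro card_mono) (auto simp: \<phi>\<psi>)
  have k0: "0 < k" using assms(7) by (simp add: k_def)

  have "\<exists>X v. conic_rep mono_fun ?A UNIV ?y X v \<and> card X \<le> (D' * k) div 2 + p + 1"
  proof (cases "\<forall>P\<in>F. \<exists>z. param \<psi>0 \<psi> z P")
    case True
    then obtain X v where X: "conic_rep mono_fun ?A UNIV ?y X v"
      "card X \<le> (D' * k) div 2 + card {t. poly \<psi>0 t = 0} + 1"
      using finite_rule_reduction[where \<psi> = \<psi>, OF \<psi>0 deg k0 F'] True by blast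
    have "card X \<le> (D' * k) div 2 + p + 1" using X(2) p' by linarith
    then show ?thesis using X(1) by blast
  next
    case False
    then obtain P0 where "P0 \<in> F" "\<nexists>z. param \<psi>0 \<psi> z P0" by blast
    \<comment> \<open>A point without complex parameter must be the value at infinity, so the
      denominator has full degree; this is what keeps the pole count from growing under the change
      of parameter.\<close>
    then have degD: "degree \<psi>0 = D'"
      using zariski_closure_param[OF cop inf' FC'] unfolding D'_def by blast
    then have lc: "coeff \<psi>0 D' \<noteq> 0" using \<psi>0 by auto
    define \<tau> where "\<tau> P = (SOME z. param \<psi>0 \<psi> z P)" for P
    \<comment> \<open>The new parameter \<open>1 / (t - t0)\<close> sends \<open>t0\<close> to
      infinity, so \<open>t0\<close> must differ from all parameters chosen for points of
      \<open>F\<close>.\<close>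
    obtain t0 where t0: "t0 \<notin> (Re \<circ> \<tau>) ` F"
      using ex_new_if_finite[OF infinite_UNIV_char_0 finite_imageI[OF finF, of "Re \<circ> \<tau>"]] by blast
    have par: "\<exists>z. param (moebius D' t0 \<psi>0) (\<lambda>i. moebius D' t0 (\<psi> i)) z P" if P: "P \<in> F" for P
    proof (cases "\<exists>z. param \<psi>0 \<psi> z P")
      case True
      then have "param \<psi>0 \<psi> (\<tau> P) P" unfolding \<tau>_def by (rule someI_ex)
      moreover have "\<tau> P \<noteq> of_real t0" using t0 P by (auto simp: image_iff)
      ultimately show ?thesis using param_moebius[where \<psi> = \<psi>, OF _ deg] by blast
    next
      case False
      then show ?thesis
        using zariski_closure_param[OF cop inf' FC'[OF P], folded D'_def] param_moebius_infinity[OF lc] by blast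
    qed
    obtain X v where X: "conic_rep mono_fun ?A UNIV ?y X v"
      "card X \<le> (D' * k) div 2 + card {t. poly (moebius D' t0 \<psi>0) t = 0} + 1"
      using finite_rule_reduction[where \<psi> = "\<lambda>i. moebius D' t0 (\<psi> i)",
          OF card_roots_moebius(1)[OF lc deg(1)] degree_moebius degree_moebius k0 F' par] by blast
    have "card X \<le> (D' * k) div 2 + p + 1"
      using X(2) card_roots_moebius(2)[OF lc deg(1), of t0] p' by linarith
    then show ?thesis using X(1) by blast
  qed
  then obtain X u where X: "conic_rep mono_fun ?A UNIV ?y X u" "card X \<le> (D' * k) div 2 + p + 1"
    by blast
  have "quadrature_rule M k X u"
    unfolding quadrature_rule_def
  proof (intro conjI ballI)
    fix f :: "real ^ 'n \<Rightarrow> real" assume "f \<in> poly_fun_le k"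
    then obtain c where c: "f = (\<lambda>x. \<Sum>\<alpha>\<in>?A. c \<alpha> * mono_fun \<alpha> x)"
      by (auto simp: poly_fun_le_def fun_eq_iff)
    show "integrable M f" unfolding c using int by (intro Bochner_Integration.integrable_sum) auto
    have "(LINT x|M. f x) = (\<Sum>\<alpha>\<in>?A. LINT x|M. c \<alpha> * mono_fun \<alpha> x)"
      unfolding c using int by (intro Bochner_Integration.integral_sum) auto
    also have "\<dots> = (\<Sum>\<alpha>\<in>?A. \<Sum>x\<in>X. u x * (c \<alpha> * mono_fun \<alpha> x))"
      using X(1) by (intro sum.cong) (auto simp: conic_rep_def sum_distrib_left algebra_simps)
    also have "\<dots> = (\<Sum>x\<in>X. u x * f x)" unfolding c by (subst sum.swap) (simp add: sum_distrib_left)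
    finally show "(LINT x|M. f x) = (\<Sum>x\<in>X. u x * f x)" .
  qed (use X(1) in \<open>auto simp: conic_rep_def\<close>)
  moreover have "int (card X) \<le> int D * int s - \<lceil>real D / 2\<rceil> + int p + 1"
  proof -
    have "card X \<le> (D * k) div 2 + p + 1"
    proof -
      have "(D' * k) div 2 \<le> (D * k) div 2" using D'D by (intro div_le_mono mult_le_mono1)
      then show ?thesis using X(2) by linarith
    qed
    \<comment> \<open>As \<open>D * k = 2 * (D * s) - D\<close>, halving and rounding down subtracts
      half of \<open>D\<close> rounded up.\<close>
    moreover have "int ((D * k) div 2) = int D * int s - \<lceil>real D / 2\<rceil>"
    proof -
      have k': "D * k + D = 2 * (D * s)" using assms(7) by (simp add: k_def algebra_simps)
      obtain e where e: "\<lceil>real D / 2\<rceil> = int e" "(D * k) div 2 + e = D * s"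
      proof (cases "even D")
        case True
        then obtain e where e: "D = 2 * e" by blast
        have "\<lceil>real D / 2\<rceil> = int e" unfolding e by simp
        moreover have "a div 2 + e = b" if "a + D = 2 * b" for a b using that e by presburger
        then have "(D * k) div 2 + e = D * s" using k' by blast
        ultimately show ?thesis by (rule that)
      next
        case False
        then obtain e where e: "D = 2 * e + 1" by (elim oddE)
        have "\<lceil>real D / 2\<rceil> = int (e + 1)" unfolding e by (intro ceiling_unique) auto
        moreover have "a div 2 + (e + 1) = b" if "a + D = 2 * b" for a b using that e by presburger
        then have "(D * k) div 2 + (e + 1) = D * s" using k' by blast
        ultimately show ?thesis by (rule that)
      qed
      have "int ((D * k) div 2 + e) = int (D * s)" using e(2) by (rule arg_cong)
      then show ?thesis using e(1) unfolding of_nat_add of_nat_mult by linarith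
    qed
    ultimately show ?thesis by linarith
  qed
  ultimately show ?thesis unfolding k_def by blast
qed

end
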